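(* Let $F:(Q,\{\cdot,\cdot\}_Q)\hookrightarrow(\mathbb{R}^n,\{\cdot,\cdot\}_\pi)$ be a Poisson embedding with $F(0)=0$, where $Q=V/G$ is a symplectic quotient and $\pi$ is the Poisson bivector of the bracket on $\mathbb{R}^n$. Write $\pi=\sum_{l\ge 1}\pi^l$, where $\pi^l$ has homogeneous coefficients of degree $l$, and for $k\ge1$ let $\pi^{(k)}$ denote the induced Poisson bivector on the $k$-th infinitesimal neighborhood $\mathcal{N}^k_{\{0\}}(\mathbb{R}^n)$ of the origin, i.e. the class of $\sum_{l=1}^k\pi^l$. Let $\mathfrak{g}\cong\mathbb{R}^n$ be the Lie algebra (spanned by the coordinate functions) corresponding to the linear Poisson structure $(\mathbb{R}^n,\pi^1)$. Then: 1. $\mathfrak{g}$ is a Lie algebra extension of the cotangent Lie algebra $\mathfrak{m}_0/\mathfrak{m}_0^2$ of $Q$ at $0$; that is, there is a short exact sequence of Lie algebras $0\to K\to\mathfrak{g}\to\mathfrak{m}_0/\mathfrak{m}_0^2\to0$. 2. For each $k\ge2$, the extension $\pi^{(k)}$ satisfies the $\mathfrak{g}$-cohomological equation $$\mathrm{d}_{\mathfrak{g}}\pi^{k}=-\tfrac12\,[\,i_{k*}\pi^{(k-1)},\,i_{k*}\pi^{(k-1)}\,]$$ on $\mathcal{N}^k_{\{0\}}(\mathbb{R}^n)$, where $i_k:\mathcal{N}^{k-1}_{\{0\}}(\mathbb{R}^n)\hookrightarrow\mathcal{N}^{k}_{\{0\}}(\mathbb{R}^n)$ is the inclusion.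
   Context: $V=\mathbb{R}^{2m}$ carries the standard symplectic Poisson bracket, $G\subseteq\mathrm{Sp}(V)$ is a compact group acting linearly, and $0\in V$ is an isolated fixed point (the standing assumption is used in the form: the ring $\mathrm{Sym}(V^* )^G$ of invariant polynomials contains no linear terms). $Q=V/G$ has coordinate ring $\mathrm{Sym}(V^* )^G$ with the restricted Poisson bracket $\{\cdot,\cdot\}_Q$; $\mathfrak{m}_0$ is the maximal ideal of the image of $0$ in this ring. Its cotangent Lie algebra is $\mathfrak{m}_0/\mathfrak{m}_0^2$ with the bracket induced by $\{\cdot,\cdot\}_Q$. A Poisson embedding $F$ is given here by a surjective homomorphism of Poisson algebras $F^*:\mathbb{R}[x_1,\dots,x_n]\to\mathrm{Sym}(V^* )^G$. The bivector $\pi$ is related to the bracket by $\pi(df\wedge dg)=\{f,g\}_\pi$; the Jacobi identity is equivalent to $[\pi,\pi]=0$ for the Schouten bracket $[\cdot,\cdot]$. The bivector vanishes at the origin, and $\pi^1$ is itself a Poisson bivector; $\mathfrak{g}=\mathrm{Span}\{x_1,\dots,x_n\}$ with Lie bracket $[x_i,x_j]=\pi^1(dx_i,dx_j)$. Let $\mathfrak{n}=(x_1,\dots,x_n)$. The $k$-th infinitesimal neighborhood is $\mathcal{N}^k_{\{0\}}(\mathbb{R}^n)=\mathrm{Spec}(\mathbb{R}[x_1,\dots,x_n]/\mathfrak{n}^{k+1})$; a bivector on it means a bivector field on $\mathbb{R}^n$ with coefficients taken modulo $\mathfrak{n}^{k+1}$, and similarly for trivectors. $i_{k*}\pi^{(k-1)}$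 is the bivector $\pi^1+\dots+\pi^{k-1}$ regarded on $\mathcal{N}^k_{\{0\}}(\mathbb{R}^n)$. The differential is $\mathrm{d}_{\mathfrak{g}}\beta=[\pi^1,\beta]$, which under the identification of bivectors having homogeneous coefficients with cochains $\bigwedge^2\mathfrak{g}\to\mathrm{Sym}(\mathfrak{g})$ is the Chevalley–Eilenberg differential of $\mathfrak{g}$ with coefficients in $\mathrm{Sym}(\mathfrak{g})$. *)

theory Defs
  imports
    "HOL-Analysis.Analysis"
    "HOL-Library.Poly_Mapping"
    "HOL-Algebra.Algebraic_Closure_Type"
    "HOL-Algebra.Ideal_Product"
    "HOL-Algebra.QuotRing"
    "HOL-Algebra.Module"
begin

unbundle no Formal_Power_Series.fps_syntax

section \<open>Real polynomials in finitely many variables\<close>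

text \<open>A polynomial is a finitely supported map from exponent vectors to coefficients; the ring
  structure is the convolution product of \<^theory>\<open>HOL-Library.Poly_Mapping\<close>. The variables are
  indexed by a finite type.\<close>

type_synonym 'i mpoly = "('i \<Rightarrow>\<^sub>0 nat) \<Rightarrow>\<^sub>0 real"

definition Const :: "real \<Rightarrow> 'i mpoly" where
  "Const c = Poly_Mapping.single 0 c"

definition coord :: "'i \<Rightarrow> 'i mpoly" where
  "coord i = Poly_Mapping.single (Poly_Mapping.single i 1) 1"

definition peval :: "('i::finite) mpoly \<Rightarrow> real ^ 'i \<Rightarrow> real" where
  "peval f v = (\<Sum>e\<in>Poly_Mapping.keys f.
     Poly_Mapping.lookup f e * (\<Prod>i\<in>UNIV. (v $ i) ^ Poly_Mapping.lookup e i))"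

text \<open>Monomials not involving the variable contribute a zero coefficient, so the truncated
  subtraction of exponents is harmless.\<close>

definition pdiff :: "'i \<Rightarrow> ('i::finite) mpoly \<Rightarrow> 'i mpoly" where
  "pdiff i f = (\<Sum>e\<in>Poly_Mapping.keys f.
     Poly_Mapping.single (e - Poly_Mapping.single i 1)
       (real (Poly_Mapping.lookup e i) * Poly_Mapping.lookup f e))"

definition homog :: "nat \<Rightarrow> ('i::finite) mpoly \<Rightarrow> 'i mpoly" where
  "homog d f = (\<Sum>e\<in>{e \<in> Poly_Mapping.keys f. (\<Sum>i\<in>UNIV. Poly_Mapping.lookup e i) = d}.
     Poly_Mapping.single e (Poly_Mapping.lookup f e))"

abbreviation poly_ring :: "'i mpoly ring" where
  "poly_ring \<equiv> ring_of_type_algebra"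

section \<open>Poisson algebras of polynomials\<close>

definition poisson_algebra :: "'i mpoly set \<Rightarrow> ('i mpoly \<Rightarrow> 'i mpoly \<Rightarrow> 'i mpoly) \<Rightarrow> bool" where
  "poisson_algebra A br \<longleftrightarrow>
     (\<forall>c. Const c \<in> A) \<and>
     (\<forall>f\<in>A. \<forall>g\<in>A. f + g \<in> A \<and> f * g \<in> A \<and> br f g \<in> A) \<and>
     (\<forall>f\<in>A. \<forall>g\<in>A. br f g = - br g f) \<and>
     (\<forall>c. \<forall>f\<in>A. \<forall>g\<in>A. br (Const c * f) g = Const c * br f g) \<and>
     (\<forall>f\<in>A. \<forall>g\<in>A. \<forall>h\<in>A. br (f + g) h = br f h + br g h) \<and>
     (\<forall>f\<in>A. \<forall>g\<in>A. \<forall>h\<in>A. br f (br g h) + br g (br h f) + br h (br f g) = 0) \<and>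
     (\<forall>f\<in>A. \<forall>g\<in>A. \<forall>h\<in>A. br f (g * h) = br f g * h + g * br f h)"

definition poisson_hom ::
  "'i mpoly set \<Rightarrow> ('i mpoly \<Rightarrow> 'i mpoly \<Rightarrow> 'i mpoly) \<Rightarrow>
   'j mpoly set \<Rightarrow> ('j mpoly \<Rightarrow> 'j mpoly \<Rightarrow> 'j mpoly) \<Rightarrow> ('i mpoly \<Rightarrow> 'j mpoly) \<Rightarrow> bool" where
  "poisson_hom A brA B brB \<phi> \<longleftrightarrow>
     \<phi> \<in> A \<rightarrow> B \<and>
     (\<forall>c. \<phi> (Const c) = Const c) \<and>
     (\<forall>f\<in>A. \<forall>g\<in>A. \<phi> (f + g) = \<phi> f + \<phi> g \<and> \<phi> (f * g) = \<phi> f * \<phi> g \<and>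
        \<phi> (brA f g) = brB (\<phi> f) (\<phi> g))"

section \<open>Symplectic quotients\<close>

text \<open>The coordinates of the symplectic vector space of dimension \<open>2m\<close> are indexed by
  \<^typ>\<open>'m + 'm\<close>: \<^term>\<open>Inl i\<close> is the position and \<^term>\<open>Inr i\<close> the momentum index.\<close>

definition omega :: "real ^ ('m::finite + 'm) \<Rightarrow> real ^ ('m + 'm) \<Rightarrow> real" where
  "omega u v = (\<Sum>i\<in>UNIV. u $ Inl i * v $ Inr i - u $ Inr i * v $ Inl i)"

definition Sp :: "(real ^ ('m::finite + 'm) ^ ('m + 'm)) set" where
  "Sp = {A. \<forall>u v. omega (A *v u) (A *v v) = omega u v}"

definition compact_symplectic_group :: "(real ^ ('m::finite + 'm) ^ ('m + 'm)) set \<Rightarrow> bool" where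
  "compact_symplectic_group G \<longleftrightarrow> G \<subseteq> Sp \<and> compact G \<and> mat 1 \<in> G \<and>
     (\<forall>A\<in>G. \<forall>B\<in>G. A ** B \<in> G) \<and> (\<forall>A\<in>G. matrix_inv A \<in> G)"

definition fixed_points :: "(real ^ 'v::finite ^ 'v) set \<Rightarrow> (real ^ 'v) set" where
  "fixed_points G = {v. \<forall>A\<in>G. A *v v = v}"

definition canonical_bracket ::
  "('m::finite + 'm) mpoly \<Rightarrow> ('m + 'm) mpoly \<Rightarrow> ('m + 'm) mpoly" where
  "canonical_bracket f g =
     (\<Sum>i\<in>UNIV. pdiff (Inl i) f * pdiff (Inr i) g - pdiff (Inr i) f * pdiff (Inl i) g)"

definition invariant_polys :: "(real ^ 'v::finite ^ 'v) set \<Rightarrow> 'v mpoly set" where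
  "invariant_polys G = {f. \<forall>A\<in>G. \<forall>v. peval f (A *v v) = peval f v}"

definition invariant_ring :: "(real ^ 'v::finite ^ 'v) set \<Rightarrow> 'v mpoly ring" where
  "invariant_ring G = poly_ring\<lparr>carrier := invariant_polys G\<rparr>"

definition max_ideal_0 :: "(real ^ 'v::finite ^ 'v) set \<Rightarrow> 'v mpoly set" where
  "max_ideal_0 G = {f \<in> invariant_polys G. peval f 0 = 0}"

text \<open>The map from the symplectic vector space to \<open>\<real>\<^sup>n\<close>, constant on orbits, which is dual to an
  algebra homomorphism from \<open>\<real>[x\<^sub>1,\<dots>,x\<^sub>n]\<close> to the invariants.\<close>

definition dual_map ::
  "('n::finite mpoly \<Rightarrow> 'v::finite mpoly) \<Rightarrow> real ^ 'v \<Rightarrow> real ^ 'n" where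
  "dual_map \<phi> v = (\<chi> i. peval (\<phi> (coord i)) v)"

section \<open>Real Lie algebras\<close>

text \<open>The fields \<open>mult\<close> and \<open>one\<close> inherited from the module record carry no meaning here.\<close>

record 'a lie_struct = "(real, 'a) module" +
  lie_bracket :: "'a \<Rightarrow> 'a \<Rightarrow> 'a"

definition real_lie_algebra :: "'a lie_struct \<Rightarrow> bool" where
  "real_lie_algebra L \<longleftrightarrow>
     module (ring_of_type_algebra :: real ring) L \<and>
     (\<forall>x\<in>carrier L. \<forall>y\<in>carrier L. lie_bracket L x y \<in> carrier L) \<and>
     (\<forall>x\<in>carrier L. \<forall>y\<in>carrier L. \<forall>z\<in>carrier L.
        lie_bracket L (x \<oplus>\<^bsub>L\<^esub> y) z = lie_bracket L x z \<oplus>\<^bsub>L\<^esub> lie_bracket L y z \<and>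
        lie_bracket L z (x \<oplus>\<^bsub>L\<^esub> y) = lie_bracket L z x \<oplus>\<^bsub>L\<^esub> lie_bracket L z y) \<and>
     (\<forall>c. \<forall>x\<in>carrier L. \<forall>y\<in>carrier L.
        lie_bracket L (c \<odot>\<^bsub>L\<^esub> x) y = c \<odot>\<^bsub>L\<^esub> lie_bracket L x y \<and>
        lie_bracket L x (c \<odot>\<^bsub>L\<^esub> y) = c \<odot>\<^bsub>L\<^esub> lie_bracket L x y) \<and>
     (\<forall>x\<in>carrier L. lie_bracket L x x = \<zero>\<^bsub>L\<^esub>) \<and>
     (\<forall>x\<in>carrier L. \<forall>y\<in>carrier L. \<forall>z\<in>carrier L.
        lie_bracket L x (lie_bracket L y z) \<oplus>\<^bsub>L\<^esub> lie_bracket L y (lie_bracket L z x)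
          \<oplus>\<^bsub>L\<^esub> lie_bracket L z (lie_bracket L x y) = \<zero>\<^bsub>L\<^esub>)"

definition lie_hom :: "'a lie_struct \<Rightarrow> 'b lie_struct \<Rightarrow> ('a \<Rightarrow> 'b) set" where
  "lie_hom L M = {h. h \<in> carrier L \<rightarrow> carrier M \<and>
     (\<forall>x\<in>carrier L. \<forall>y\<in>carrier L. h (x \<oplus>\<^bsub>L\<^esub> y) = h x \<oplus>\<^bsub>M\<^esub> h y) \<and>
     (\<forall>c. \<forall>x\<in>carrier L. h (c \<odot>\<^bsub>L\<^esub> x) = c \<odot>\<^bsub>M\<^esub> h x) \<and>
     (\<forall>x\<in>carrier L. \<forall>y\<in>carrier L. h (lie_bracket L x y) = lie_bracket M (h x) (h y))}"

definition lie_short_exact ::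
  "'k lie_struct \<Rightarrow> ('k \<Rightarrow> 'a) \<Rightarrow> 'a lie_struct \<Rightarrow> ('a \<Rightarrow> 'b) \<Rightarrow> 'b lie_struct \<Rightarrow> bool" where
  "lie_short_exact K \<iota> L p M \<longleftrightarrow>
     real_lie_algebra K \<and> real_lie_algebra L \<and> real_lie_algebra M \<and>
     \<iota> \<in> lie_hom K L \<and> p \<in> lie_hom L M \<and>
     inj_on \<iota> (carrier K) \<and> \<iota> ` carrier K = {x \<in> carrier L. p x = \<zero>\<^bsub>M\<^esub>} \<and>
     p ` carrier L = carrier M"

text \<open>The kernel embeds into \<open>L\<close>, so no generality is lost by giving its elements the type of
  those of \<open>L\<close>.\<close>

definition lie_extension :: "'a lie_struct \<Rightarrow> 'b lie_struct \<Rightarrow> bool" where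
  "lie_extension L M \<longleftrightarrow> (\<exists>(K :: 'a lie_struct) \<iota> p. lie_short_exact K \<iota> L p M)"

text \<open>Quotient by a Lie ideal, on additive cosets; compare \<^const>\<open>FactRing\<close>.\<close>

definition lie_quotient :: "'a lie_struct \<Rightarrow> 'a set \<Rightarrow> 'a set lie_struct" where
  "lie_quotient L I =
     \<lparr>carrier = a_rcosets\<^bsub>L\<^esub> I, mult = rcoset_mult L I, one = I +>\<^bsub>L\<^esub> \<one>\<^bsub>L\<^esub>,
      zero = I, add = set_add L,
      smult = (\<lambda>c S. \<Union>x\<in>S. I +>\<^bsub>L\<^esub> (c \<odot>\<^bsub>L\<^esub> x)),
      lie_bracket = (\<lambda>S T. \<Union>x\<in>S. \<Union>y\<in>T. I +>\<^bsub>L\<^esub> lie_bracket L x y)\<rparr>"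

definition poly_lie :: "'i mpoly set \<Rightarrow> ('i mpoly \<Rightarrow> 'i mpoly \<Rightarrow> 'i mpoly) \<Rightarrow> 'i mpoly lie_struct"
  where
  "poly_lie S br =
     \<lparr>carrier = S, mult = (*), one = 1, zero = 0, add = (+),
      smult = (\<lambda>c f. Const c * f), lie_bracket = br\<rparr>"

definition cotangent_lie_algebra ::
  "(real ^ ('m::finite + 'm) ^ ('m + 'm)) set \<Rightarrow> ('m + 'm) mpoly set lie_struct" where
  "cotangent_lie_algebra G =
     lie_quotient (poly_lie (max_ideal_0 G) canonical_bracket)
       (ideal_prod (invariant_ring G) (max_ideal_0 G) (max_ideal_0 G))"

section \<open>Bivectors and trivectors on affine space\<close>

text \<open>A bivector is given by its skew-symmetric coefficient matrix, that is
  \<open>\<pi> = \<Sum>\<^bsub>i<j\<^esub> \<pi> i j \<partial>\<^sub>i \<and> \<partial>\<^sub>j = (1/2) \<Sum>\<^bsub>i,j\<^esub> \<pi> i j \<partial>\<^sub>i \<and> \<partial>\<^sub>j\<close>, and a trivector likewise by its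
  totally skew-symmetric coefficients.\<close>

type_synonym 'n bivector = "'n \<Rightarrow> 'n \<Rightarrow> 'n mpoly"
type_synonym 'n trivector = "'n \<Rightarrow> 'n \<Rightarrow> 'n \<Rightarrow> 'n mpoly"

definition is_bivector :: "'n bivector \<Rightarrow> bool" where
  "is_bivector \<pi> \<longleftrightarrow> (\<forall>i j. \<pi> i j = - \<pi> j i)"

text \<open>\<open>\<pi>(df \<and> dg)\<close>\<close>

definition pairing :: "('n::finite) bivector \<Rightarrow> 'n mpoly \<Rightarrow> 'n mpoly \<Rightarrow> 'n mpoly" where
  "pairing \<pi> f g = (\<Sum>i\<in>UNIV. \<Sum>j\<in>UNIV. \<pi> i j * pdiff i f * pdiff j g)"

definition is_bivector_of ::
  "('n::finite) bivector \<Rightarrow> ('n mpoly \<Rightarrow> 'n mpoly \<Rightarrow> 'n mpoly) \<Rightarrow> bool" where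
  "is_bivector_of \<pi> br \<longleftrightarrow> is_bivector \<pi> \<and> (\<forall>f g. pairing \<pi> f g = br f g)"

text \<open>Coefficients of the Schouten bracket of two bivectors. The sign and normalisation are those of
  \<open>[X\<^sub>1 \<and> X\<^sub>2, Y\<^sub>1 \<and> Y\<^sub>2] = \<Sum>\<^bsub>a,b\<^esub> (-1)\<^bsup>a+b\<^esup> [X\<^sub>a, Y\<^sub>b] \<and> X\<^bsub>3-a\<^esub> \<and> Y\<^bsub>3-b\<^esub>\<close>.\<close>

definition schouten :: "('n::finite) bivector \<Rightarrow> 'n bivector \<Rightarrow> 'n trivector" where
  "schouten \<alpha> \<beta> i j k =
     (\<Sum>l\<in>UNIV. \<alpha> i l * pdiff l (\<beta> j k) + \<beta> i l * pdiff l (\<alpha> j k)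
            + \<alpha> j l * pdiff l (\<beta> k i) + \<beta> j l * pdiff l (\<alpha> k i)
            + \<alpha> k l * pdiff l (\<beta> i j) + \<beta> k l * pdiff l (\<alpha> i j))"

definition homog_bivector :: "nat \<Rightarrow> ('n::finite) bivector \<Rightarrow> 'n bivector" where
  "homog_bivector d \<pi> = (\<lambda>i j. homog d (\<pi> i j))"

text \<open>\<open>\<pi>\<^sup>1 + \<dots> + \<pi>\<^sup>k\<close>\<close>

definition trunc_bivector :: "nat \<Rightarrow> ('n::finite) bivector \<Rightarrow> 'n bivector" where
  "trunc_bivector k \<pi> = (\<lambda>i j. \<Sum>l=1..k. homog_bivector l \<pi> i j)"

text \<open>For a linear Poisson bivector \<open>\<rho>\<close>, the Lie algebra on the span of the coordinate functions and its
  differential on 2-cochains with polynomial coefficients. Lemma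
  \<open>d_lie_chevalley_eilenberg\<close> below relates the latter to the Chevalley--Eilenberg formula.\<close>

definition linear_lie_algebra :: "('n::finite) bivector \<Rightarrow> 'n mpoly lie_struct" where
  "linear_lie_algebra \<rho> =
     poly_lie (range (\<lambda>c. \<Sum>i\<in>UNIV. Const (c i) * coord i)) (pairing \<rho>)"

definition d_lie :: "('n::finite) bivector \<Rightarrow> 'n bivector \<Rightarrow> 'n trivector" where
  "d_lie \<rho> \<beta> = schouten \<rho> \<beta>"

section \<open>Infinitesimal neighborhoods of the origin\<close>

definition origin_ideal :: "('n::finite) mpoly set" where
  "origin_ideal = genideal poly_ring (range coord)"

definition nbhd_ideal :: "nat \<Rightarrow> ('n::finite) mpoly set" where
  "nbhd_ideal k = origin_ideal [^]\<^bsub>ideals_set poly_ring\<^esub> (k + 1)"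

text \<open>Multivectors on the \<open>k\<close>-th neighborhood have coefficients in
  \<^term>\<open>FactRing poly_ring (nbhd_ideal k)\<close>. The Schouten bracket of bivectors there is the class of
  the bracket of representatives: as long as these vanish at the origin, changing them modulo
  \<open>\<nn>\<^bsup>k+1\<^esup>\<close> changes the bracket only modulo \<open>\<nn>\<^bsup>k+1\<^esup>\<close>, since the derivative of an element of
  \<open>\<nn>\<^bsup>k+1\<^esup>\<close> lies in \<open>\<nn>\<^sup>k\<close>. Here \<open>\<nn>\<close> is \<^const>\<open>origin_ideal\<close>.\<close>

definition nbhd_bivector :: "nat \<Rightarrow> ('n::finite) bivector \<Rightarrow> 'n \<Rightarrow> 'n \<Rightarrow> 'n mpoly set" where
  "nbhd_bivector k \<pi> = (\<lambda>i j. nbhd_ideal k +>\<^bsub>poly_ring\<^esub> \<pi> i j)"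

definition nbhd_trivector :: "nat \<Rightarrow> ('n::finite) trivector \<Rightarrow> 'n \<Rightarrow> 'n \<Rightarrow> 'n \<Rightarrow> 'n mpoly set" where
  "nbhd_trivector k T = (\<lambda>i j l. nbhd_ideal k +>\<^bsub>poly_ring\<^esub> T i j l)"

section \<open>Consistency of the sign conventions\<close>

lemma pdiff_coord: "pdiff i (coord j) = (if i = j then 1 else 0)"
  by (auto simp: pdiff_def coord_def lookup_single)

lemma pairing_coord_left: "pairing \<pi> (coord i) f = (\<Sum>l\<in>UNIV. \<pi> i l * pdiff l f)"
proof -
  have "pairing \<pi> (coord i) f = (\<Sum>i'\<in>UNIV. if i' = i then (\<Sum>j\<in>UNIV. \<pi> i' j * pdiff j f) else 0)"
    unfolding pairing_def by (rule sum.cong) (auto simp: pdiff_coord)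
  thus ?thesis by simp
qed

lemma pairing_coord_right: "pairing \<pi> f (coord k) = (\<Sum>l\<in>UNIV. \<pi> l k * pdiff l f)"
proof -
  have "(\<Sum>j\<in>UNIV. \<pi> i j * pdiff i f * pdiff j (coord k)) = \<pi> i k * pdiff i f" for i
  proof -
    have "(\<Sum>j\<in>UNIV. \<pi> i j * pdiff i f * pdiff j (coord k))
        = (\<Sum>j\<in>UNIV. if j = k then \<pi> i j * pdiff i f else 0)"
      by (rule sum.cong) (auto simp: pdiff_coord)
    thus ?thesis by simp
  qed
  thus ?thesis by (simp add: pairing_def)
qed

lemma pairing_coord: "pairing \<pi> (coord i) (coord j) = \<pi> i j"
proof -
  have "(\<Sum>l\<in>UNIV. \<pi> i l * pdiff l (coord j)) = (\<Sum>l\<in>UNIV. if l = j then \<pi> i l else 0)"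
    by (rule sum.cong) (auto simp: pdiff_coord)
  thus ?thesis by (simp add: pairing_coord_left)
qed

text \<open>\<open>[\<pi>,\<pi>]\<close> is twice the Jacobiator of the coordinate functions.\<close>

lemma schouten_self_jacobiator:
  "schouten \<pi> \<pi> i j k =
     2 * (pairing \<pi> (coord i) (pairing \<pi> (coord j) (coord k)) + pairing \<pi> (coord j) (pairing \<pi> (coord k) (coord i))
        + pairing \<pi> (coord k) (pairing \<pi> (coord i) (coord j)))"
  unfolding pairing_coord unfolding schouten_def pairing_coord_left sum.distrib mult_2
  by (simp only: ac_simps)

text \<open>The differential is the Chevalley--Eilenberg differential of the cochain
  \<open>u \<and> v \<mapsto> \<beta>(du \<and> dv)\<close>, where a linear form acts on polynomials by its bracket.\<close>

lemma d_lie_chevalley_eilenberg: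
  fixes \<rho> \<beta> :: "('n::finite) bivector"
  assumes "is_bivector \<rho>" "is_bivector \<beta>"
  defines "b \<equiv> pairing \<beta>" and "br \<equiv> pairing \<rho>"
  shows "d_lie \<rho> \<beta> i j k =
     br (coord i) (b (coord j) (coord k)) - br (coord j) (b (coord i) (coord k))
     + br (coord k) (b (coord i) (coord j)) - b (br (coord i) (coord j)) (coord k)
     + b (br (coord i) (coord k)) (coord j) - b (br (coord j) (coord k)) (coord i)"
proof -
  have skew: "\<beta> l m = - \<beta> m l" for l m using assms(2) unfolding is_bivector_def by blast
  have pm: "pdiff l (- f) = - pdiff l f" for l and f :: "'n mpoly"
  proof -
    have "Poly_Mapping.keys (- f) = Poly_Mapping.keys f"
      by (auto simp: in_keys_iff)
    thus ?thesis by (simp add: pdiff_def single_uminus sum_negf)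
  qed
  have neg: "(\<Sum>l\<in>UNIV. \<beta> l m * pdiff l f) = - (\<Sum>l\<in>UNIV. \<beta> m l * pdiff l f)" for m f
    unfolding sum_negf[symmetric] by (rule sum.cong[OF refl]) (subst skew, simp)
  have jac: "(\<Sum>l\<in>UNIV. \<rho> j l * pdiff l (\<beta> i k)) = - (\<Sum>l\<in>UNIV. \<rho> j l * pdiff l (\<beta> k i))"
    unfolding skew[of i k] pm mult_minus_right sum_negf by simp
  have rho: "\<rho> i k = - \<rho> k i" using assms(1) unfolding is_bivector_def by blast
  show ?thesis
    unfolding b_def br_def pairing_coord rho unfolding d_lie_def schouten_def pairing_coord_left pairing_coord_right
      sum.distrib neg jac pm mult_minus_right sum_negf
    by simp
qed

end

theory Submission
  imports Defs
begin

text \<open>Everything is governed by the filtration of the polynomial ring by the order of vanishing at the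
  origin, that is by the powers of the ideal of the origin. A Schouten bracket takes one derivative, so it
  sends bivectors of orders \<open>a\<close> and \<open>b\<close> to a trivector of order \<open>a + b - 1\<close> (\<open>schouten_order_ge\<close>).

  The symplectic geometry enters in one place only. An invariant polynomial has an invariant linear part;
  the symplectic form turns it into a vector fixed by \<open>G\<close>, together with all its multiples, and so an isolated
  fixed point forces it to vanish (\<open>linear_part_invariant_imp_zero\<close>). Therefore the Poisson bracket of two
  invariants vanishes at \<open>0\<close>. The bracket \<open>\<pi> i j\<close> of two coordinates is mapped by \<open>F_star\<close> to such a
  bracket, and \<open>F_star\<close> preserves the value at the origin (\<open>const_coeff_poisson_hom\<close>), so \<open>\<pi>\<close> vanishes at the
  origin. This is what makes \<open>\<pi>\<^sup>(\<^sup>k\<^sup>)\<close> and \<open>\<pi>\<^sup>1\<close> meaningful.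

  For the cohomological equation, \<open>[\<pi>,\<pi>] = 0\<close> is the Jacobi identity on coordinates. Discarding from \<open>\<pi>\<close> the
  terms of degree above \<open>k\<close> changes \<open>[\<pi>,\<pi>]\<close> in order at least \<open>k + 1\<close> only. Splitting the rest as
  \<open>T + \<pi>\<^sup>k\<close> with \<open>T = \<pi>\<^sup>1 + \<dots> + \<pi>\<^sup>k\<^sup>-\<^sup>1\<close>, the term \<open>[\<pi>\<^sup>k,\<pi>\<^sup>k]\<close> and the part \<open>[T - \<pi>\<^sup>1,\<pi>\<^sup>k]\<close> of the cross term also
  have order at least \<open>k + 1\<close>, which leaves \<open>[T,T] + 2[\<pi>\<^sup>1,\<pi>\<^sup>k]\<close> (\<open>maurer_cartan_defect\<close>).

  For the extension, taking linear parts identifies the linear forms, under the bracket of \<open>\<pi>\<^sup>1\<close>, with \<open>\<nn>/\<nn>\<^sup>2\<close>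
  under the bracket induced by \<open>\<pi>\<close>. A surjective Poisson homomorphism that preserves the value at the origin maps \<open>\<nn>\<close>
  onto \<open>\<mm>\<^sub>0\<close> and \<open>\<nn>\<^sup>2\<close> into \<open>\<mm>\<^sub>0\<^sup>2\<close>; hence it induces a surjection of Lie algebras
  onto \<open>\<mm>\<^sub>0/\<mm>\<^sub>0\<^sup>2\<close> (\<open>lie_extension_linearised_embedding\<close>). Closure of the invariants under the canonical
  bracket, the Jacobi identity and the Leibniz rule there are inherited through the surjection from the polynomial ring
  (\<open>poisson_algebra_image\<close>).\<close>

section \<open>Polynomials filtered by the order of vanishing at the origin\<close>

definition mon_degree :: "('i::finite \<Rightarrow>\<^sub>0 nat) \<Rightarrow> nat" where
  "mon_degree e = (\<Sum>i\<in>UNIV. Poly_Mapping.lookup e i)"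

lemma mon_degree_add: "mon_degree (d + e) = mon_degree d + mon_degree e"
  by (simp add: mon_degree_def lookup_add sum.distrib)

lemma mon_degree_single [simp]: "mon_degree (Poly_Mapping.single i n) = n"
  by (simp add: mon_degree_def lookup_single when_def)

lemma mon_degree_zero [simp]: "mon_degree 0 = 0"
  by (simp add: mon_degree_def)

lemma mon_degree_eq_0_iff: "mon_degree e = 0 \<longleftrightarrow> e = 0"
  by (auto simp: mon_degree_def intro: poly_mapping_eqI)

lemma mon_degree_Suc_split:
  assumes "mon_degree e = Suc d"
  obtains i e' where "e = Poly_Mapping.single i 1 + e'" "mon_degree e' = d"
proof -
  obtain i where i: "Poly_Mapping.lookup e i > 0"
    using assms by (metis mon_degree_eq_0_iff gr0I lookup_zero nat.distinct(1) poly_mapping_eqI)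
  have "e = Poly_Mapping.single i 1 + (e - Poly_Mapping.single i 1)"
    using i by (intro poly_mapping_eqI) (auto simp: lookup_add lookup_minus lookup_single when_def)
  moreover from this have "mon_degree (e - Poly_Mapping.single i 1) = d"
    using assms by (metis mon_degree_add mon_degree_single add_left_cancel plus_1_eq_Suc)
  ultimately show thesis using that by blast
qed

lemma lookup_Const: "Poly_Mapping.lookup (Const c) e = (if e = 0 then c else 0)"
  by (auto simp: Const_def lookup_single when_def)

lemma lookup_Const_mult [simp]: "Poly_Mapping.lookup (Const c * f) e = c * Poly_Mapping.lookup f e"
  unfolding Const_def mult_map_scale_conv_mult[symmetric] by (simp add: map.rep_eq when_def)

lemma Const_0 [simp]: "Const 0 = 0" and Const_1 [simp]: "Const 1 = 1"
  by (simp_all add: Const_def)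

lemma Const_add: "Const (a + b) = Const a + Const b"
  by (simp add: Const_def single_add)

lemma Const_mult: "Const (a * b) = Const a * Const b"
  by (simp add: Const_def mult_single)

lemma uminus_eq_Const_mult: "- f = Const (- 1) * f"
  by (rule poly_mapping_eqI) simp

lemma coord_mult_single:
  "coord i * Poly_Mapping.single e c = Poly_Mapping.single (Poly_Mapping.single i 1 + e) c"
  by (simp add: coord_def mult_single)

text \<open>Only the monomial \<open>e + single i 1\<close> of \<open>f\<close> can contribute to the coefficient of \<open>e\<close>. A monomial of exponent
  \<open>x\<close> without the variable \<open>i\<close> may also satisfy \<open>x - single i 1 = e\<close>, but its factor \<open>lookup x i\<close> is zero.\<close>

lemma lookup_pdiff:
  "Poly_Mapping.lookup (pdiff i f) e =
     real (Poly_Mapping.lookup e i + 1) * Poly_Mapping.lookup f (e + Poly_Mapping.single i 1)"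
proof -
  have iff: "x - Poly_Mapping.single i 1 = e \<longleftrightarrow> x = e + Poly_Mapping.single i 1"
    if "Poly_Mapping.lookup x i \<noteq> 0" for x
    using that by (auto simp: poly_mapping_eq_iff fun_eq_iff lookup_add lookup_minus lookup_single when_def split: if_splits)
  have "Poly_Mapping.lookup (pdiff i f) e = (\<Sum>x\<in>Poly_Mapping.keys f.
      if x = e + Poly_Mapping.single i 1
      then real (Poly_Mapping.lookup e i + 1) * Poly_Mapping.lookup f x else 0)"
    unfolding pdiff_def lookup_sum
  proof (rule sum.cong[OF refl])
    fix x
    show "Poly_Mapping.lookup (Poly_Mapping.single (x - Poly_Mapping.single i 1)
        (real (Poly_Mapping.lookup x i) * Poly_Mapping.lookup f x)) e =
      (if x = e + Poly_Mapping.single i 1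
       then real (Poly_Mapping.lookup e i + 1) * Poly_Mapping.lookup f x else 0)"
      using iff[of x] by (cases "Poly_Mapping.lookup x i = 0")
        (auto simp: lookup_single when_def lookup_add)
  qed
  also have "\<dots> = real (Poly_Mapping.lookup e i + 1) * Poly_Mapping.lookup f (e + Poly_Mapping.single i 1)"
    by (simp add: sum.delta not_in_keys_iff_lookup_eq_zero)
  finally show ?thesis .
qed

lemma pdiff_add: "pdiff i (f + g) = pdiff i f + pdiff i g"
  by (rule poly_mapping_eqI) (simp add: lookup_pdiff lookup_add algebra_simps)

lemma lookup_homog: "Poly_Mapping.lookup (homog d f) e = (if mon_degree e = d then Poly_Mapping.lookup f e else 0)"
proof -
  have "Poly_Mapping.lookup (homog d f) e =
      (\<Sum>x\<in>{x \<in> Poly_Mapping.keys f. mon_degree x = d}. if x = e then Poly_Mapping.lookup f x else 0)"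
    unfolding homog_def lookup_sum mon_degree_def
    by (rule sum.cong) (auto simp: lookup_single when_def)
  thus ?thesis by (simp add: sum.delta not_in_keys_iff_lookup_eq_zero)
qed

text \<open>The \<open>d\<close>-th power of the ideal of the origin, described by coefficients so that membership
  can be read off from the monomials.\<close>

definition order_ge :: "nat \<Rightarrow> ('i::finite) mpoly set" where
  "order_ge d = {f. \<forall>e. Poly_Mapping.lookup f e \<noteq> 0 \<longrightarrow> d \<le> mon_degree e}"

lemma order_ge_0 [simp]: "f \<in> order_ge 0"
  by (simp add: order_ge_def)

lemma order_ge_zero [simp]: "0 \<in> order_ge d"
  by (simp add: order_ge_def)

lemma order_ge_1_iff: "f \<in> order_ge 1 \<longleftrightarrow> Poly_Mapping.lookup f 0 = 0"
  unfolding order_ge_def by (auto simp: Suc_le_eq mon_degree_eq_0_iff neq0_conv[symmetric] simp del: neq0_conv)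

lemma order_ge_mono: "f \<in> order_ge d \<Longrightarrow> c \<le> d \<Longrightarrow> f \<in> order_ge c"
  by (auto simp: order_ge_def)

lemma order_ge_add: "f \<in> order_ge d \<Longrightarrow> g \<in> order_ge d \<Longrightarrow> f + g \<in> order_ge d"
  by (auto simp: order_ge_def lookup_add) (metis add.right_neutral)

lemma order_ge_uminus: "f \<in> order_ge d \<Longrightarrow> - f \<in> order_ge d"
  by (simp add: order_ge_def)

lemma order_ge_diff: "f \<in> order_ge d \<Longrightarrow> g \<in> order_ge d \<Longrightarrow> f - g \<in> order_ge d"
  using order_ge_add[of f d "- g"] order_ge_uminus[of g d] by simp

lemma order_ge_sum: "(\<And>x. x \<in> A \<Longrightarrow> f x \<in> order_ge d) \<Longrightarrow> sum f A \<in> order_ge d"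
  by (induction A rule: infinite_finite_induct) (auto intro: order_ge_add)

lemma order_ge_double: "f \<in> order_ge d \<Longrightarrow> 2 * f \<in> order_ge d"
  unfolding mult_2 by (rule order_ge_add)

lemma order_ge_Const_mult: "f \<in> order_ge d \<Longrightarrow> Const c * f \<in> order_ge d"
  by (simp add: order_ge_def)

lemma order_ge_mult:
  assumes "f \<in> order_ge a" "g \<in> order_ge b"
  shows "f * g \<in> order_ge (a + b)"
  unfolding order_ge_def
proof safe
  fix e assume "Poly_Mapping.lookup (f * g) e \<noteq> 0"
  hence "e \<in> Poly_Mapping.keys (f * g)" by (simp add: in_keys_iff)
  then obtain x y where "e = x + y" "x \<in> Poly_Mapping.keys f" "y \<in> Poly_Mapping.keys g"
    using keys_mult[of f g] by blast
  thus "a + b \<le> mon_degree e"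
    using assms by (auto simp: order_ge_def mon_degree_add in_keys_iff intro: add_mono)
qed

lemma order_ge_pdiff: "f \<in> order_ge d \<Longrightarrow> pdiff i f \<in> order_ge (d - 1)"
  unfolding order_ge_def by (fastforce simp: lookup_pdiff mon_degree_add)

lemma order_ge_homog: "homog d f \<in> order_ge d"
  by (simp add: order_ge_def lookup_homog)

lemma homog_eq_0: "f \<in> order_ge c \<Longrightarrow> d < c \<Longrightarrow> homog d f = 0"
  by (rule poly_mapping_eqI) (fastforce simp: order_ge_def lookup_homog)

lemma homog_add: "homog d (f + g) = homog d f + homog d g"
  by (rule poly_mapping_eqI) (simp add: lookup_homog lookup_add)

lemma homog_diff: "homog d (f - g) = homog d f - homog d g"
  by (rule poly_mapping_eqI) (simp add: lookup_homog lookup_minus)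

lemma homog_uminus: "homog d (- f) = - homog d f"
  by (rule poly_mapping_eqI) (simp add: lookup_homog)

lemma homog_Const_mult: "homog d (Const c * f) = Const c * homog d f"
  by (rule poly_mapping_eqI) (simp add: lookup_homog)

lemma homog_sum: "homog d (sum f A) = (\<Sum>x\<in>A. homog d (f x))"
  by (rule poly_mapping_eqI) (simp add: lookup_homog lookup_sum)

lemma homog_idem: "homog d (homog d f) = homog d f"
  by (rule poly_mapping_eqI) (simp add: lookup_homog)

lemma lookup_sum_homog:
  "Poly_Mapping.lookup (\<Sum>l=a..b. homog l f) e = (if mon_degree e \<in> {a..b} then Poly_Mapping.lookup f e else 0)"
  by (simp add: lookup_sum lookup_homog sum.delta)

text \<open>The sums of homogeneous components here start in degree \<open>1\<close>, as in \<open>trunc_bivector\<close>, and so lose the constant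
  term; this is why vanishing at the origin is assumed.\<close>

lemma order_ge_diff_trunc:
  assumes "f \<in> order_ge 1"
  shows "f - (\<Sum>l=1..k. homog l f) \<in> order_ge (k + 1)"
  using assms by (fastforce simp: order_ge_def lookup_minus lookup_sum_homog)

lemma trunc_eventually_exact:
  assumes "f \<in> order_ge 1" "\<And>e. Poly_Mapping.lookup f e \<noteq> 0 \<Longrightarrow> mon_degree e \<le> N"
  shows "f = (\<Sum>l=1..N. homog l f)"
  using assms by (intro poly_mapping_eqI) (fastforce simp: order_ge_def lookup_sum_homog)

lemma sum_monomials:
  "f = (\<Sum>e\<in>Poly_Mapping.keys f. Poly_Mapping.single e (Poly_Mapping.lookup f e))"
  by (rule poly_mapping_eqI)
    (auto simp: lookup_sum lookup_single when_def sum.delta not_in_keys_iff_lookup_eq_zero)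

lemma order_ge_induct [consumes 1, case_names zero add monomial]:
  assumes "f \<in> order_ge d" "P 0" "\<And>f g. P f \<Longrightarrow> P g \<Longrightarrow> P (f + g)"
    and mono: "\<And>e c. d \<le> mon_degree e \<Longrightarrow> P (Poly_Mapping.single e c)"
  shows "P f"
proof -
  have "P (\<Sum>e\<in>A. Poly_Mapping.single e (Poly_Mapping.lookup f e))"
    if "finite A" "A \<subseteq> Poly_Mapping.keys f" for A
    using that
  proof (induction A rule: finite_induct)
    case (insert e A)
    hence "P (Poly_Mapping.single e (Poly_Mapping.lookup f e))"
      using assms(1) by (intro mono) (auto simp: order_ge_def in_keys_iff)
    thus ?case using insert assms(3) by simp
  qed (use assms(2) in simp)
  from this[of "Poly_Mapping.keys f"] sum_monomials[of f] show ?thesis by simp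
qed

text \<open>A monomial of positive degree is divisible by some coordinate. In the applications the predicate is
  membership in a product of ideals, or that a homomorphism maps the polynomial into an ideal.\<close>

lemma order_ge_Suc_induct [consumes 1, case_names zero add coord_mult]:
  assumes "f \<in> order_ge (Suc d)" "P 0" "\<And>f g. P f \<Longrightarrow> P g \<Longrightarrow> P (f + g)"
    and coord_mult: "\<And>i g. g \<in> order_ge d \<Longrightarrow> P (coord i * g)"
  shows "P f"
  using assms(1)
proof (induction rule: order_ge_induct)
  case (monomial e c)
  then obtain n where "mon_degree e = Suc n" "d \<le> n" by (metis Suc_le_D Suc_le_mono)
  then obtain i e' where "e = Poly_Mapping.single i 1 + e'" "d \<le> mon_degree e'"
    by (metis mon_degree_Suc_split)
  moreover from this have "Poly_Mapping.single e' c \<in> order_ge d"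
    by (simp add: order_ge_def lookup_single when_def)
  ultimately show ?case using coord_mult coord_mult_single by metis
qed (use assms in auto)

lemma homog_1_eq: "homog 1 f = (\<Sum>i\<in>UNIV. Const (Poly_Mapping.lookup f (Poly_Mapping.single i 1)) * coord i)"
proof (rule poly_mapping_eqI)
  fix e :: "'a \<Rightarrow>\<^sub>0 nat"
  have R: "Poly_Mapping.lookup (\<Sum>i\<in>UNIV. Const (Poly_Mapping.lookup f (Poly_Mapping.single i 1)) * coord i) e
    = (\<Sum>i\<in>UNIV. if Poly_Mapping.single i 1 = e then Poly_Mapping.lookup f e else 0)"
    by (simp add: lookup_sum coord_def lookup_single when_def)
      (rule sum.cong, auto)
  show "Poly_Mapping.lookup (homog 1 f) e =
    Poly_Mapping.lookup (\<Sum>i\<in>UNIV. Const (Poly_Mapping.lookup f (Poly_Mapping.single i 1)) * coord i) e"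
  proof (cases "mon_degree e = 1")
    case True
    then obtain i where e: "e = Poly_Mapping.single i 1"
      using mon_degree_Suc_split[of e 0] by (metis One_nat_def mon_degree_eq_0_iff add.right_neutral)
    have "Poly_Mapping.single j (1::nat) = e \<longleftrightarrow> j = i" for j
      unfolding e by (metis lookup_single_eq lookup_single_not_eq zero_neq_one)
    thus ?thesis using True unfolding R by (simp add: lookup_homog)
  next
    case False
    hence "Poly_Mapping.single j (1::nat) \<noteq> e" for j by auto
    thus ?thesis using False unfolding R by (simp add: lookup_homog)
  qed
qed

lemma linear_forms_eq: "range (\<lambda>c. \<Sum>i\<in>UNIV. Const (c i) * coord i) = {f. homog 1 f = f}"
proof safe
  fix c :: "'a \<Rightarrow> real"
  have "homog 1 (coord i) = coord i" for i :: 'a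
    by (rule poly_mapping_eqI) (auto simp: lookup_homog coord_def lookup_single when_def)
  thus "homog 1 (\<Sum>i\<in>UNIV. Const (c i) * coord i) = (\<Sum>i\<in>UNIV. Const (c i) * coord i)"
    by (simp add: homog_sum homog_Const_mult)
next
  fix f :: "'a mpoly" assume "homog 1 f = f"
  thus "f \<in> range (\<lambda>c. \<Sum>i\<in>UNIV. Const (c i) * coord i)"
    by (intro range_eqI[where x = "\<lambda>i. Poly_Mapping.lookup f (Poly_Mapping.single i 1)"])
      (simp only: homog_1_eq[symmetric])
qed

text \<open>A monomial of degree \<open>d + 1\<close> is a coordinate times a monomial of degree \<open>d\<close>, which is the recursion of the
  ideal powers. This inclusion is how all congruences modulo \<open>\<nn>\<^sup>k\<^sup>+\<^sup>1\<close> are established.\<close>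

lemma nbhd_ideal_contains_order_ge:
  shows "ideal (nbhd_ideal k :: ('n::finite) mpoly set) poly_ring"
    and "order_ge (k + 1) \<subseteq> (nbhd_ideal k :: 'n mpoly set)"
proof -
  define I :: "'n mpoly set" where "I = origin_ideal"
  have c: "coord i \<in> I" for i
    unfolding I_def origin_ideal_def genideal_def by auto
  have id: "ideal I (poly_ring :: 'n mpoly ring)"
    unfolding I_def origin_ideal_def
    by (intro ring.genideal_ideal ring_from_type_algebra) (simp add: ring_of_type_algebra_def)
  have P: "ideal (I [^]\<^bsub>ideals_set poly_ring\<^esub> (d::nat)) poly_ring \<and> order_ge d \<subseteq> I [^]\<^bsub>ideals_set poly_ring\<^esub> d" for d
  proof (induction d)
    case 0
    have "ideal (carrier (poly_ring :: 'n mpoly ring)) poly_ring"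
      by (intro ring.oneideal ring_from_type_algebra)
    thus ?case by (simp add: nat_pow_def ideals_set_def) (simp add: ring_of_type_algebra_def)
  next
    case (Suc d)
    define J where "J = I [^]\<^bsub>ideals_set poly_ring\<^esub> d"
    have S: "I [^]\<^bsub>ideals_set poly_ring\<^esub> Suc d = ideal_prod poly_ring J I"
      unfolding J_def by (simp add: nat_pow_def ideals_set_def)
    have id': "ideal (ideal_prod poly_ring J I) poly_ring"
      using Suc id unfolding J_def by (intro ring.ideal_prod_is_ideal ring_from_type_algebra) auto
    have "f \<in> ideal_prod poly_ring J I" if "f \<in> order_ge (Suc d)" for f
      using that
    proof (induction rule: order_ge_Suc_induct)
      case zero
      show ?case using additive_subgroup.zero_closed[OF ideal.axioms(1)[OF id']]
        by (simp add: ring_of_type_algebra_def)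
    next
      case (add f g)
      from ideal_prod.sum[OF this] show ?case by (simp add: ring_of_type_algebra_def)
    next
      case (coord_mult i g)
      hence "g \<in> J" using Suc unfolding J_def by blast
      from ideal_prod.prod[OF this c[of i], of poly_ring] show ?case
        by (simp add: ring_of_type_algebra_def mult.commute)
    qed
    thus ?case unfolding S using id' by blast
  qed
  from P[of "k + 1"] show "ideal (nbhd_ideal k :: 'n mpoly set) poly_ring"
    and "order_ge (k + 1) \<subseteq> (nbhd_ideal k :: 'n mpoly set)"
    unfolding nbhd_ideal_def I_def by blast+
qed


lemma nbhd_class_eqI:
  assumes "f - g \<in> order_ge (k + 1)"
  shows "nbhd_ideal k +>\<^bsub>poly_ring\<^esub> f = nbhd_ideal k +>\<^bsub>poly_ring\<^esub> (g :: ('n::finite) mpoly)"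
proof -
  interpret ideal "nbhd_ideal k :: 'n mpoly set" poly_ring
    by (rule nbhd_ideal_contains_order_ge)
  have c: "carrier (poly_ring :: 'n mpoly ring) = UNIV"
    by (simp add: ring_of_type_algebra_def)
  have "f - g \<in> nbhd_ideal k" using assms nbhd_ideal_contains_order_ge(2) by blast
  hence "f \<in> nbhd_ideal k +>\<^bsub>poly_ring\<^esub> g"
    unfolding a_r_coset_def' by (auto simp: ring_of_type_algebra_def intro!: bexI[of _ "f - g"])
  thus ?thesis by (metis a_repr_independence c UNIV_I is_additive_subgroup a_subgroup)
qed

section \<open>The Schouten bracket and the filtration\<close>

lemma schouten_commute: "schouten \<alpha> \<beta> = schouten \<beta> \<alpha>"
  by (intro ext) (simp add: schouten_def sum.distrib ac_simps)

lemma schouten_add_left: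
  "schouten (\<lambda>i j. \<alpha> i j + \<alpha>' i j) \<beta> i j k = schouten \<alpha> \<beta> i j k + schouten \<alpha>' \<beta> i j k"
  by (simp add: schouten_def pdiff_add algebra_simps sum.distrib)

lemma schouten_add_right:
  "schouten \<alpha> (\<lambda>i j. \<beta> i j + \<beta>' i j) i j k = schouten \<alpha> \<beta> i j k + schouten \<alpha> \<beta>' i j k"
  by (simp add: schouten_commute[of \<alpha>] schouten_add_left)

lemma schouten_add_self:
  "schouten (\<lambda>i j. \<alpha> i j + \<beta> i j) (\<lambda>i j. \<alpha> i j + \<beta> i j) i j k =
     schouten \<alpha> \<alpha> i j k + 2 * schouten \<alpha> \<beta> i j k + schouten \<beta> \<beta> i j k"
  unfolding mult_2 by (simp add: schouten_add_left schouten_add_right schouten_commute[of \<beta> \<alpha>])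

text \<open>Each summand differentiates exactly one of the two factors.\<close>

lemma schouten_order_ge:
  assumes "\<And>i j. \<alpha> i j \<in> order_ge a" "\<And>i j. \<beta> i j \<in> order_ge b"
  shows "schouten \<alpha> \<beta> i j k \<in> order_ge (a + b - 1)"
proof -
  have "\<alpha> i j * pdiff l (\<beta> i' j') \<in> order_ge (a + b - 1)" for i j l i' j'
    by (rule order_ge_mono[OF order_ge_mult[OF assms(1) order_ge_pdiff[OF assms(2)]]]) simp
  moreover have "\<beta> i j * pdiff l (\<alpha> i' j') \<in> order_ge (a + b - 1)" for i j l i' j'
    by (rule order_ge_mono[OF order_ge_mult[OF assms(2) order_ge_pdiff[OF assms(1)]]]) simp
  ultimately show ?thesis
    unfolding schouten_def by (intro order_ge_sum order_ge_add)
qed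

text \<open>With \<open>R\<close> the discarded tail, \<open>0 = [T + R, T + R]\<close> expresses \<open>[T,T]\<close> through \<open>[T,R]\<close> and \<open>[R,R]\<close>, and \<open>T\<close> vanishes
  at the origin, so neither term has lower order than \<open>R\<close>.\<close>

lemma schouten_trunc_self:
  assumes "\<And>i j. \<pi> i j \<in> order_ge 1" "\<And>i j l. schouten \<pi> \<pi> i j l = 0" "1 \<le> k"
  shows "schouten (trunc_bivector k \<pi>) (trunc_bivector k \<pi>) i j l \<in> order_ge (k + 1)"
proof -
  define T where "T = trunc_bivector k \<pi>"
  define R where "R = (\<lambda>i j. \<pi> i j - T i j)"
  have R: "R i j \<in> order_ge (k + 1)" for i j
    unfolding R_def T_def trunc_bivector_def homog_bivector_def
    using assms(1) by (rule order_ge_diff_trunc)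
  have T: "T i j \<in> order_ge 1" for i j
    unfolding T_def trunc_bivector_def homog_bivector_def
    by (intro order_ge_sum order_ge_mono[OF order_ge_homog]) simp
  have "\<pi> = (\<lambda>i j. T i j + R i j)" by (simp add: R_def)
  hence "schouten T T i j l = - (2 * schouten T R i j l + schouten R R i j l)"
    using assms(2)[of i j l] schouten_add_self[of T R i j l]
    by (intro eq_neg_iff_add_eq_0[THEN iffD2]) (simp add: add.assoc)
  moreover have "schouten T R i j l \<in> order_ge (k + 1)"
    using schouten_order_ge[of T 1 R "k + 1"] T R by simp
  moreover have "schouten R R i j l \<in> order_ge (k + 1)"
    by (rule order_ge_mono[OF schouten_order_ge[of R "k + 1" R "k + 1"]]) (use R in auto)
  ultimately have "schouten T T i j l \<in> order_ge (k + 1)"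
    by (metis order_ge_uminus order_ge_add order_ge_double)
  thus ?thesis by (simp add: T_def)
qed

text \<open>Here \<open>U = T - \<pi>\<^sup>1\<close> has order \<open>2\<close>, so \<open>[U,\<pi>\<^sup>k]\<close> has order \<open>k + 1\<close>, and \<open>[\<pi>\<^sup>k,\<pi>\<^sup>k]\<close> has order \<open>2k - 1\<close>, which
  is at least \<open>k + 1\<close> exactly because \<open>k \<ge> 2\<close>. Twice the difference below is \<open>[\<pi>\<^sup>(\<^sup>k\<^sup>),\<pi>\<^sup>(\<^sup>k\<^sup>)]\<close> minus such terms.\<close>

lemma maurer_cartan_defect:
  assumes "\<And>i j. \<pi> i j \<in> order_ge 1" "\<And>i j l. schouten \<pi> \<pi> i j l = 0" "2 \<le> k"
  defines "T \<equiv> trunc_bivector (k - 1) \<pi>"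
  shows "schouten (homog_bivector 1 \<pi>) (homog_bivector k \<pi>) i j l
           - Const (- 1 / 2) * schouten T T i j l \<in> order_ge (k + 1)"
proof -
  define P where "P = homog_bivector k \<pi>"
  define L where "L = homog_bivector 1 \<pi>"
  define U where "U = (\<lambda>i j. T i j - L i j)"
  have P: "P i j \<in> order_ge k" for i j
    by (simp add: P_def homog_bivector_def order_ge_homog)
  have U: "U i j \<in> order_ge 2" for i j
    using assms(3) unfolding U_def T_def L_def trunc_bivector_def homog_bivector_def order_ge_def
    by (auto simp: lookup_minus lookup_homog lookup_sum_homog)
  have "trunc_bivector k \<pi> = (\<lambda>i j. T i j + P i j)"
    using assms(3) by (cases k) (auto simp: T_def P_def trunc_bivector_def fun_eq_iff)
  moreover have "(\<lambda>i j. L i j + U i j) = T" by (simp add: U_def)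
  hence "schouten T P i j l = schouten L P i j l + schouten U P i j l"
    using schouten_add_left[of L U P i j l] by simp
  ultimately have "schouten (trunc_bivector k \<pi>) (trunc_bivector k \<pi>) i j l
         - 2 * schouten U P i j l - schouten P P i j l =
     schouten T T i j l + 2 * schouten L P i j l"
    using schouten_add_self[of T P i j l] by (simp add: distrib_left)
  moreover have "Const (1 / 2) * (2 * f) = f" for f :: "'a mpoly"
  proof -
    have "(2 :: 'a mpoly) = Const 2" by (simp add: Const_def)
    thus ?thesis by (simp only: mult.assoc[symmetric] Const_mult[symmetric]) simp
  qed
  moreover have "Const (- 1 / 2) * f = - (Const (1 / 2) * f)" for f :: "'a mpoly"
    by (rule poly_mapping_eqI) simp
  ultimately have "schouten L P i j l - Const (- 1 / 2) * schouten T T i j l = Const (1 / 2) *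
      (schouten (trunc_bivector k \<pi>) (trunc_bivector k \<pi>) i j l
         - 2 * schouten U P i j l - schouten P P i j l)"
    by (simp add: distrib_left)
  moreover have "schouten (trunc_bivector k \<pi>) (trunc_bivector k \<pi>) i j l \<in> order_ge (k + 1)"
    using assms by (intro schouten_trunc_self) auto
  moreover have "schouten U P i j l \<in> order_ge (k + 1)"
    using schouten_order_ge[of U 2 P k] U P by simp
  moreover have "schouten P P i j l \<in> order_ge (k + 1)"
    by (rule order_ge_mono[OF schouten_order_ge[of P k P k]]) (use P assms(3) in auto)
  ultimately have "schouten L P i j l - Const (- 1 / 2) * schouten T T i j l \<in> order_ge (k + 1)"
    by (metis order_ge_Const_mult order_ge_diff order_ge_double)
  thus ?thesis by (simp add: L_def P_def)
qed

section \<open>Lie algebras of polynomials and their quotients\<close>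

lemma poly_lie_sel [simp]:
  "carrier (poly_lie S' br') = S'" "x \<oplus>\<^bsub>poly_lie S' br'\<^esub> y = x + y" "\<zero>\<^bsub>poly_lie S' br'\<^esub> = 0"
  "c \<odot>\<^bsub>poly_lie S' br'\<^esub> x = Const c * x" "lie_bracket (poly_lie S' br') = br'"
  by (simp_all add: poly_lie_def)

text \<open>A linear space of polynomials that is a Lie algebra under a given bracket. All Lie algebras below are of
  this form, or quotients of such by an ideal.\<close>

locale poly_lie_algebra =
  fixes S :: "('i::finite) mpoly set" and br :: "'i mpoly \<Rightarrow> 'i mpoly \<Rightarrow> 'i mpoly"
  assumes zero_mem: "0 \<in> S"
    and add_mem: "x \<in> S \<Longrightarrow> y \<in> S \<Longrightarrow> x + y \<in> S"
    and scale_mem: "x \<in> S \<Longrightarrow> Const c * x \<in> S"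
    and br_mem: "x \<in> S \<Longrightarrow> y \<in> S \<Longrightarrow> br x y \<in> S"
    and br_add: "x \<in> S \<Longrightarrow> y \<in> S \<Longrightarrow> z \<in> S \<Longrightarrow> br (x + y) z = br x z + br y z"
    and br_scale: "x \<in> S \<Longrightarrow> y \<in> S \<Longrightarrow> br (Const c * x) y = Const c * br x y"
    and br_skew: "x \<in> S \<Longrightarrow> y \<in> S \<Longrightarrow> br x y = - br y x"
    and br_jacobi: "x \<in> S \<Longrightarrow> y \<in> S \<Longrightarrow> z \<in> S \<Longrightarrow>
      br x (br y z) + br y (br z x) + br z (br x y) = 0"
begin

lemma uminus_mem: "x \<in> S \<Longrightarrow> - x \<in> S"
  unfolding uminus_eq_Const_mult[of x] by (rule scale_mem)

lemma br_add_right: "x \<in> S \<Longrightarrow> y \<in> S \<Longrightarrow> z \<in> S \<Longrightarrow> br z (x + y) = br z x + br z y"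
  using br_skew[of z "x + y"] br_skew[of z x] br_skew[of z y] by (simp add: br_add add_mem)

lemma br_scale_right: "x \<in> S \<Longrightarrow> y \<in> S \<Longrightarrow> br x (Const c * y) = Const c * br x y"
  using br_skew[of x "Const c * y"] br_skew[of x y] by (simp add: br_scale scale_mem)

text \<open>Characteristic zero, applied coefficientwise.\<close>

lemma br_self: "x \<in> S \<Longrightarrow> br x x = 0"
proof (rule poly_mapping_eqI)
  fix e assume "x \<in> S"
  from br_skew[OF this this] have "Poly_Mapping.lookup (br x x) e = - Poly_Mapping.lookup (br x x) e"
    by (metis lookup_uminus)
  thus "Poly_Mapping.lookup (br x x) e = Poly_Mapping.lookup 0 e" by simp
qed

lemma real_lie_algebra_poly_lie: "real_lie_algebra (poly_lie S br)"
proof -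
  have "abelian_group (poly_lie S br)"
    by (rule abelian_groupI)
      (auto simp: add_mem zero_mem ac_simps intro!: bexI[where x = "- _"] uminus_mem)
  hence "module (ring_of_type_algebra :: real ring) (poly_lie S br)"
    by (intro moduleI cring_from_type_algebra)
      (auto simp: ring_of_type_algebra_def scale_mem distrib_left distrib_right mult.assoc Const_add Const_mult)
  thus ?thesis
    unfolding real_lie_algebra_def
    by (simp add: br_mem br_add br_add_right br_scale br_scale_right br_self br_jacobi)
qed

end

lemma (in poly_lie_algebra) subalgebra:
  assumes "T \<subseteq> S" "0 \<in> T" "\<And>x y. x \<in> T \<Longrightarrow> y \<in> T \<Longrightarrow> x + y \<in> T"
    "\<And>c x. x \<in> T \<Longrightarrow> Const c * x \<in> T" "\<And>x y. x \<in> T \<Longrightarrow> y \<in> T \<Longrightarrow> br x y \<in> T"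
  shows "poly_lie_algebra T br"
  by (unfold_locales; (rule assms(2) |
      (rule assms(3-5) br_add br_scale br_skew br_jacobi; (assumption | erule subsetD[OF assms(1)]))))

locale poly_lie_ideal = poly_lie_algebra +
  fixes I
  assumes ideal_sub: "I \<subseteq> S"
    and ideal_zero: "0 \<in> I"
    and ideal_add: "x \<in> I \<Longrightarrow> y \<in> I \<Longrightarrow> x + y \<in> I"
    and ideal_scale: "x \<in> I \<Longrightarrow> Const c * x \<in> I"
    and ideal_br: "x \<in> S \<Longrightarrow> y \<in> I \<Longrightarrow> br x y \<in> I"
begin

definition cls :: "'a mpoly \<Rightarrow> 'a mpoly set" where
  "cls x = (\<lambda>a. a + x) ` I"

abbreviation Q where "Q \<equiv> lie_quotient (poly_lie S br) I"

lemma ideal_uminus: "x \<in> I \<Longrightarrow> - x \<in> I"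
  unfolding uminus_eq_Const_mult[of x] by (rule ideal_scale)

lemma ideal_diff: "x \<in> I \<Longrightarrow> y \<in> I \<Longrightarrow> x - y \<in> I"
  using ideal_add[of x "- y"] ideal_uminus[of y] by simp

lemma ideal_mem: "x \<in> I \<Longrightarrow> x \<in> S"
  using ideal_sub by blast

lemma mem_cls: "x \<in> cls y \<longleftrightarrow> x - y \<in> I"
  unfolding cls_def by (auto intro!: image_eqI[where x = "x - y"])

lemma cls_eq_iff: "cls x = cls y \<longleftrightarrow> x - y \<in> I"
proof
  assume "cls x = cls y"
  moreover have "x \<in> cls x" by (simp add: mem_cls ideal_zero)
  ultimately show "x - y \<in> I" by (simp add: mem_cls)
next
  assume d: "x - y \<in> I"
  have "z \<in> cls x \<longleftrightarrow> z \<in> cls y" for z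
    unfolding mem_cls
  proof
    show "z - y \<in> I" if "z - x \<in> I" using ideal_add[OF that d] by simp
    show "z - x \<in> I" if "z - y \<in> I" using ideal_diff[OF that d] by simp
  qed
  thus "cls x = cls y" by blast
qed

lemma cls_self: "x \<in> cls x"
  by (simp add: mem_cls ideal_zero)

lemma cls_subset: "x \<in> S \<Longrightarrow> cls x \<subseteq> S"
  using add_mem ideal_mem by (auto simp: cls_def)

lemma cls_0: "cls 0 = I"
  by (simp add: cls_def)

lemma Q_carrier: "carrier Q = cls ` S"
  by (auto simp: lie_quotient_def A_RCOSETS_def' a_r_coset_def' cls_def)

lemma Q_zero: "\<zero>\<^bsub>Q\<^esub> = cls 0"
  by (simp add: lie_quotient_def cls_0)

lemma Q_add: "cls x \<oplus>\<^bsub>Q\<^esub> cls y = cls (x + y)"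
proof -
  have "cls x \<oplus>\<^bsub>Q\<^esub> cls y = (\<Union>h\<in>cls x. \<Union>k\<in>cls y. {h + k})"
    by (simp add: lie_quotient_def set_add_def')
  also have "\<dots> = cls (x + y)"
  proof safe
    fix h k assume "h \<in> cls x" "k \<in> cls y"
    thus "h + k \<in> cls (x + y)"
      using ideal_add[of "h - x" "k - y"] by (simp add: mem_cls algebra_simps)
  next
    fix z assume "z \<in> cls (x + y)"
    hence "z - y \<in> cls x" by (simp add: mem_cls algebra_simps)
    thus "z \<in> (\<Union>h\<in>cls x. \<Union>k\<in>cls y. {h + k})"
      using cls_self[of y] by (intro UN_I[of "z - y"] UN_I[of y]) auto
  qed
  finally show ?thesis .
qed

lemma Q_smult: "c \<odot>\<^bsub>Q\<^esub> cls x = cls (Const c * x)"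
proof -
  have "c \<odot>\<^bsub>Q\<^esub> cls x = (\<Union>z\<in>cls x. cls (Const c * z))"
    by (auto simp: lie_quotient_def a_r_coset_def' cls_def)
  also have "cls (Const c * z) = cls (Const c * x)" if "z \<in> cls x" for z
    using ideal_scale[of "z - x" c] that by (simp add: cls_eq_iff mem_cls algebra_simps)
  hence "(\<Union>z\<in>cls x. cls (Const c * z)) = cls (Const c * x)"
    using cls_self[of x] by blast
  finally show ?thesis .
qed

text \<open>Independence of the representatives:
  \<open>{z,w} = {z, w - y} + {z - x, y} + {x,y}\<close>, where the first two terms lie in the ideal.\<close>

lemma Q_bracket:
  assumes "x \<in> S" "y \<in> S"
  shows "lie_bracket Q (cls x) (cls y) = cls (br x y)"
proof -
  have "lie_bracket Q (cls x) (cls y) = (\<Union>z\<in>cls x. \<Union>w\<in>cls y. cls (br z w))"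
    by (auto simp: lie_quotient_def a_r_coset_def' cls_def)
  also have "cls (br z w) = cls (br x y)" if "z \<in> cls x" "w \<in> cls y" for z w
  proof -
    have mem: "z \<in> S" "w \<in> S" "z - x \<in> I" "w - y \<in> I"
      using that assms cls_subset[of x] cls_subset[of y] by (blast, blast, simp_all add: mem_cls)
    have "br z (w - y) \<in> I" using mem by (simp add: ideal_br)
    moreover have "br y (z - x) \<in> I" using mem assms by (simp add: ideal_br)
    hence "br (z - x) y \<in> I"
      using br_skew[of "z - x" y] mem assms by (simp add: ideal_uminus ideal_mem)
    moreover have "br z w = br z (w - y) + br z y"
      using br_add_right[of "w - y" y z] mem assms by (simp add: ideal_mem)
    moreover have "br z y = br (z - x) y + br x y"
      using br_add[of "z - x" x y] mem assms by (simp add: ideal_mem)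
    ultimately show ?thesis
      using ideal_add[of "br z (w - y)" "br (z - x) y"] by (simp add: cls_eq_iff add.assoc)
  qed
  hence "(\<Union>z\<in>cls x. \<Union>w\<in>cls y. cls (br z w)) = cls (br x y)"
    using cls_self[of x] cls_self[of y] by blast
  finally show ?thesis .
qed


lemma real_lie_algebra_quotient: "real_lie_algebra (lie_quotient (poly_lie S br) I)"
proof -
  have inv: "\<exists>y\<in>S. cls (x + y) = cls 0" if "x \<in> S" for x
    using that by (intro bexI[of _ "- x"]) (simp_all add: uminus_mem)
  have "abelian_group Q"
    by (rule abelian_groupI; unfold Q_carrier; (elim imageE)?)
      (simp_all add: Q_add Q_zero add_mem zero_mem ac_simps inv)
  hence "module (ring_of_type_algebra :: real ring) Q"
    by (intro moduleI cring_from_type_algebra)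
      (auto simp: ring_of_type_algebra_def Q_carrier Q_add Q_smult scale_mem distrib_left distrib_right
        mult.assoc Const_add Const_mult)
  thus ?thesis
    unfolding real_lie_algebra_def Q_carrier
    by (simp add: Q_add Q_smult Q_zero Q_bracket add_mem scale_mem
        br_mem br_add br_add_right br_scale br_scale_right br_self br_jacobi)
qed

end

section \<open>Poisson algebras\<close>

lemma poisson_algebraD:
  assumes "poisson_algebra A br"
  shows "Const c \<in> A"
    and "f \<in> A \<Longrightarrow> g \<in> A \<Longrightarrow> f + g \<in> A"
    and "f \<in> A \<Longrightarrow> g \<in> A \<Longrightarrow> f * g \<in> A"
    and "f \<in> A \<Longrightarrow> g \<in> A \<Longrightarrow> br f g \<in> A"
    and "f \<in> A \<Longrightarrow> g \<in> A \<Longrightarrow> br f g = - br g f"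
    and "f \<in> A \<Longrightarrow> g \<in> A \<Longrightarrow> br (Const c * f) g = Const c * br f g"
    and "f \<in> A \<Longrightarrow> g \<in> A \<Longrightarrow> h \<in> A \<Longrightarrow> br (f + g) h = br f h + br g h"
    and "f \<in> A \<Longrightarrow> g \<in> A \<Longrightarrow> h \<in> A \<Longrightarrow> br f (br g h) + br g (br h f) + br h (br f g) = 0"
    and "f \<in> A \<Longrightarrow> g \<in> A \<Longrightarrow> h \<in> A \<Longrightarrow> br f (g * h) = br f g * h + g * br f h"
proof -
  note a = assms[unfolded poisson_algebra_def]
  show "Const c \<in> A" by (rule a[THEN conjunct1, rule_format])
  note a = a[THEN conjunct2]
  note b = a[THEN conjunct1, rule_format]
  show "f + g \<in> A" if "f \<in> A" "g \<in> A" using b[OF that] by (rule conjunct1)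
  show "f * g \<in> A" if "f \<in> A" "g \<in> A" using b[OF that] by (elim conjE)
  show "br f g \<in> A" if "f \<in> A" "g \<in> A" using b[OF that] by (elim conjE)
  note a = a[THEN conjunct2]
  show "br f g = - br g f" if "f \<in> A" "g \<in> A" using that by (rule a[THEN conjunct1, rule_format])
  note a = a[THEN conjunct2]
  show "br (Const c * f) g = Const c * br f g" if "f \<in> A" "g \<in> A"
    using that by (rule a[THEN conjunct1, rule_format])
  note a = a[THEN conjunct2]
  show "br (f + g) h = br f h + br g h" if "f \<in> A" "g \<in> A" "h \<in> A"
    using that by (rule a[THEN conjunct1, rule_format])
  note a = a[THEN conjunct2]
  show "br f (br g h) + br g (br h f) + br h (br f g) = 0" if "f \<in> A" "g \<in> A" "h \<in> A"
    using that by (rule a[THEN conjunct1, rule_format])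
  show "br f (g * h) = br f g * h + g * br f h" if "f \<in> A" "g \<in> A" "h \<in> A"
    using that by (rule a[THEN conjunct2, rule_format])
qed

lemma poisson_homD:
  assumes "poisson_hom A brA B brB \<phi>"
  shows "\<phi> (Const c) = Const c"
    and "f \<in> A \<Longrightarrow> g \<in> A \<Longrightarrow> \<phi> (f + g) = \<phi> f + \<phi> g"
    and "f \<in> A \<Longrightarrow> g \<in> A \<Longrightarrow> \<phi> (f * g) = \<phi> f * \<phi> g"
    and "f \<in> A \<Longrightarrow> g \<in> A \<Longrightarrow> \<phi> (brA f g) = brB (\<phi> f) (\<phi> g)"
  using assms unfolding poisson_hom_def by simp_all

text \<open>Each identity holds upstairs and is transported by \<open>\<phi>\<close>. Applied to the invariants, this gives their closure
  under the canonical bracket without a chain rule for linear symplectic maps.\<close>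

lemma poisson_algebra_image:
  assumes "poisson_algebra A brA" "poisson_hom A brA B brB \<phi>" "\<phi> ` A = B"
  shows "poisson_algebra B brB"
proof -
  note P = poisson_algebraD[OF assms(1)]
  note C = P(1) and cl = P(2-4)
  note h = poisson_homD[OF assms(2)]
  have 1: "Const c \<in> B" for c
    using imageI[OF C(1), of \<phi> c] assms(3) h(1) by simp
  have 2: "\<phi> f + \<phi> g \<in> B" "\<phi> f * \<phi> g \<in> B" "brB (\<phi> f) (\<phi> g) \<in> B" if "f \<in> A" "g \<in> A" for f g
    using cl(1-3)[OF that, THEN imageI, of \<phi>] assms(3) by (simp_all add: h that)
  have 3: "brB (\<phi> f) (\<phi> g) = - brB (\<phi> g) (\<phi> f)" if "f \<in> A" "g \<in> A" for f g
  proof -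
    have "brA f g = Const (- 1) * brA g f"
      unfolding uminus_eq_Const_mult[symmetric] using P(5) that .
    from arg_cong[OF this, of \<phi>] show ?thesis
      unfolding uminus_eq_Const_mult[of "brB _ _"] using that by (simp add: h cl C)
  qed
  have 4: "brB (Const c * \<phi> f) (\<phi> g) = Const c * brB (\<phi> f) (\<phi> g)" if "f \<in> A" "g \<in> A" for c f g
  proof -
    have "brA (Const c * f) g = Const c * brA f g" using P(6) that .
    from arg_cong[OF this, of \<phi>] show ?thesis using that by (simp add: h cl C)
  qed
  have 5: "brB (\<phi> f + \<phi> g) (\<phi> k) = brB (\<phi> f) (\<phi> k) + brB (\<phi> g) (\<phi> k)"
    if "f \<in> A" "g \<in> A" "k \<in> A" for f g k
  proof -
    have "brA (f + g) k = brA f k + brA g k" using P(7) that .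
    from arg_cong[OF this, of \<phi>] show ?thesis using that by (simp add: h cl)
  qed
  have 6: "brB (\<phi> f) (brB (\<phi> g) (\<phi> k)) + brB (\<phi> g) (brB (\<phi> k) (\<phi> f)) + brB (\<phi> k) (brB (\<phi> f) (\<phi> g)) = 0"
    if "f \<in> A" "g \<in> A" "k \<in> A" for f g k
  proof -
    have "brA f (brA g k) + brA g (brA k f) + brA k (brA f g) = Const 0"
      unfolding Const_0 using P(8) that .
    from arg_cong[OF this, of \<phi>] show ?thesis using that h(1)[of 0] by (simp add: h cl)
  qed
  have 7: "brB (\<phi> f) (\<phi> g * \<phi> k) = brB (\<phi> f) (\<phi> g) * \<phi> k + \<phi> g * brB (\<phi> f) (\<phi> k)"
    if "f \<in> A" "g \<in> A" "k \<in> A" for f g k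
  proof -
    have "brA f (g * k) = brA f g * k + g * brA f k" using P(9) that .
    from arg_cong[OF this, of \<phi>] show ?thesis using that by (simp add: h cl)
  qed
  note B = 1 2 3 4 5 6 7
  show ?thesis
    unfolding poisson_algebra_def assms(3)[symmetric] ball_simps(9)
    by (intro conjI allI ballI; (rule B[unfolded assms(3)[symmetric]]; assumption?))
qed

text \<open>If brackets vanish at the origin then \<open>\<mm> = A \<inter> order_ge 1\<close> is closed under the bracket, and by the Leibniz rule
  \<open>{\<mm>, \<mm>\<^sup>2} \<subseteq> {\<mm>,\<mm>}\<mm> \<subseteq> \<mm>\<^sup>2\<close>. So \<open>\<mm>/\<mm>\<^sup>2\<close> is a Lie algebra.\<close>

lemma poisson_maximal_ideal_lie_ideal:
  assumes P: "poisson_algebra A br" and van: "\<And>f g. f \<in> A \<Longrightarrow> g \<in> A \<Longrightarrow> br f g \<in> order_ge 1"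
  shows "poly_lie_ideal (A \<inter> order_ge 1) br
    (ideal_prod (poly_ring\<lparr>carrier := A\<rparr>) (A \<inter> order_ge 1) (A \<inter> order_ge 1))"
proof -
  note P' = poisson_algebraD[OF P]
  note C = P'(1) and cl = P'(2-4)
  define m where "m = A \<inter> order_ge 1"
  define J where "J = ideal_prod (poly_ring\<lparr>carrier := A\<rparr>) m m"
  have mA: "x \<in> A" if "x \<in> m" for x using that by (simp add: m_def)
  interpret m: poly_lie_algebra m br
  proof
    show "0 \<in> m" using C[of 0] by (simp add: m_def)
    show "x + y \<in> m" "br x y \<in> m" if "x \<in> m" "y \<in> m" for x y
      using that cl van by (auto simp: m_def intro: order_ge_add)
    show "Const c * x \<in> m" if "x \<in> m" for c x
      using that cl(2)[OF C, of x c] by (simp add: m_def order_ge_Const_mult)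
    show "br (x + y) z = br x z + br y z" if "x \<in> m" "y \<in> m" "z \<in> m" for x y z
      by (intro P'(7) mA that)
    show "br (Const c * x) y = Const c * br x y" if "x \<in> m" "y \<in> m" for c x y
      by (intro P'(6) mA that)
    show "br x y = - br y x" if "x \<in> m" "y \<in> m" for x y
      by (intro P'(5) mA that)
    show "br x (br y z) + br y (br z x) + br z (br x y) = 0" if "x \<in> m" "y \<in> m" "z \<in> m" for x y z
      by (intro P'(8) mA that)
  qed
  have prod: "f * g \<in> J" if "f \<in> m" "g \<in> m" for f g
    using ideal_prod.prod[of f m g m "poly_ring\<lparr>carrier := A\<rparr>"] that
    by (simp add: J_def ring_of_type_algebra_def)
  have sum: "f + g \<in> J" if "f \<in> J" "g \<in> J" for f g
    using ideal_prod.sum[of f "poly_ring\<lparr>carrier := A\<rparr>" m m g] that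
    by (simp add: J_def ring_of_type_algebra_def)
  have ind: "R f" if "f \<in> J" "\<And>f g. f \<in> m \<Longrightarrow> g \<in> m \<Longrightarrow> R (f * g)"
    "\<And>f g. f \<in> J \<Longrightarrow> g \<in> J \<Longrightarrow> R f \<Longrightarrow> R g \<Longrightarrow> R (f + g)" for f R
    using that(1) unfolding J_def
    by (induction rule: ideal_prod.induct)
      (use that(2,3) in \<open>auto simp: J_def ring_of_type_algebra_def\<close>)
  have sub: "f \<in> m" if "f \<in> J" for f
    using that
  proof (rule ind)
    fix f g assume "f \<in> m" "g \<in> m"
    thus "f * g \<in> m" using order_ge_mono[OF order_ge_mult[of f 1 g 1], of 1] cl by (auto simp: m_def)
  qed (rule m.add_mem)
  have "poly_lie_ideal m br J"
  proof
    show "J \<subseteq> m" using sub by blast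
    show "0 \<in> J" using prod[OF m.zero_mem m.zero_mem] by simp
    show "x + y \<in> J" if "x \<in> J" "y \<in> J" for x y using sum that .
    show "Const c * x \<in> J" if "x \<in> J" for c x
      using that by (rule ind) (auto simp: distrib_left mult.assoc[symmetric] intro: prod sum m.scale_mem)
    show "br x y \<in> J" if x: "x \<in> m" and "y \<in> J" for x y
      using that(2)
    proof (rule ind)
      fix f g assume "f \<in> m" "g \<in> m"
      moreover from this x have "br x (f * g) = br x f * g + f * br x g"
        by (intro P'(9) mA)
      ultimately show "br x (f * g) \<in> J" using x by (simp add: sum prod m.br_mem)
    next
      fix f g assume "f \<in> J" "g \<in> J" "br x f \<in> J" "br x g \<in> J"
      thus "br x (f + g) \<in> J" using m.br_add_right[of f g x] x sub by (simp add: sum)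
    qed
  qed
  thus ?thesis unfolding J_def m_def .
qed

section \<open>The linearised Poisson structure\<close>

lemma pairing_order_ge:
  assumes "\<And>i j. \<pi> i j \<in> order_ge 1" "f \<in> order_ge a" "g \<in> order_ge b" "1 \<le> a" "1 \<le> b"
  shows "pairing \<pi> f g \<in> order_ge (a + b - 1)"
proof -
  have "\<pi> i j * pdiff i f * pdiff j g \<in> order_ge (1 + (a - 1) + (b - 1))" for i j
    using assms by (intro order_ge_mult order_ge_pdiff)
  moreover have "1 + (a - 1) + (b - 1) = a + b - 1" using assms by simp
  ultimately show ?thesis unfolding pairing_def by (intro order_ge_sum) simp
qed

lemma pdiff_linear_form:
  assumes "homog 1 f = f"
  shows "pdiff i f = Const (Poly_Mapping.lookup f (Poly_Mapping.single i 1))"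
proof (rule poly_mapping_eqI)
  fix e
  have "Poly_Mapping.lookup f (e + Poly_Mapping.single i 1) = 0" if "e \<noteq> 0"
    using that lookup_homog[of 1 f "e + Poly_Mapping.single i 1"] unfolding assms
    by (simp add: mon_degree_add mon_degree_eq_0_iff)
  thus "Poly_Mapping.lookup (pdiff i f) e =
      Poly_Mapping.lookup (Const (Poly_Mapping.lookup f (Poly_Mapping.single i 1))) e"
    by (simp add: lookup_pdiff lookup_Const)
qed

text \<open>The differentials of linear forms are constant, so taking homogeneous components commutes with pairing
  against them.\<close>

lemma pairing_homog_linear_forms:
  assumes "homog 1 f = f" "homog 1 g = g"
  shows "pairing (homog_bivector d \<pi>) f g = homog d (pairing \<pi> f g)"
proof -
  have "homog d (Const a * p * Const b) = Const a * homog d p * Const b" for a b and p :: "'a mpoly"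
    by (metis homog_Const_mult mult.commute)
  thus ?thesis
    unfolding pairing_def homog_bivector_def homog_sum pdiff_linear_form[OF assms(1)] pdiff_linear_form[OF assms(2)]
    by (simp add: mult.commute[of _ "Const _"] mult.assoc homog_Const_mult)
qed

lemma linear_lie_algebra_eq:
  "linear_lie_algebra \<rho> = poly_lie {f. homog 1 f = f} (pairing \<rho>)"
  unfolding linear_lie_algebra_def linear_forms_eq ..

lemma linear_form_order_ge: "homog 1 f = f \<Longrightarrow> f \<in> order_ge 1"
  by (metis order_ge_homog)

text \<open>The bracket of \<open>\<pi>\<^sup>1\<close> on linear forms is the linear part of the bracket of \<open>\<pi>\<close>. In an iterated bracket the inner
  term may be replaced by its linear part, since bracketing its part of order \<open>2\<close> with a linear form gives
  order \<open>2\<close> again. Hence the Jacobi identity for \<open>\<pi>\<^sup>1\<close> is the linear part of that for \<open>\<pi>\<close>.\<close>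

lemma poly_lie_algebra_linear_forms:
  assumes P: "poisson_algebra UNIV (pairing \<pi>)" and \<pi>: "\<And>i j. \<pi> i j \<in> order_ge 1"
  shows "poly_lie_algebra {f. homog 1 f = f} (pairing (homog_bivector 1 \<pi>))"
proof -
  define S :: "'a mpoly set" where "S = {f. homog 1 f = f}"
  define br where "br = pairing \<pi>"
  define b where "b = pairing (homog_bivector 1 \<pi>)"
  note P' = poisson_algebraD[OF P, folded br_def, simplified]
  have b: "b x y = homog 1 (br x y)" if "x \<in> S" "y \<in> S" for x y
    using that pairing_homog_linear_forms[of x y 1 \<pi>] by (simp add: S_def b_def br_def)
  have mem: "homog 1 f \<in> S" for f :: "'a mpoly" by (simp add: S_def homog_idem)
  have order_ge: "x \<in> order_ge 1" if "x \<in> S" for x using that linear_form_order_ge by (simp add: S_def)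
  have bmem: "b x y \<in> S" if "x \<in> S" "y \<in> S" for x y using b[OF that] mem by simp
  have add: "x + y \<in> S" if "x \<in> S" "y \<in> S" for x y using that by (simp add: S_def homog_add)
  have scale: "Const c * x \<in> S" if "x \<in> S" for c x using that by (simp add: S_def homog_Const_mult)
  have bb: "b x (b y z) = homog 1 (br x (br y z))" if "x \<in> S" "y \<in> S" "z \<in> S" for x y z
  proof -
    define u where "u = br y z - homog 1 (br y z)"
    have "br y z \<in> order_ge 1" using pairing_order_ge[OF \<pi> order_ge order_ge, of y z] that by (simp add: br_def)
    hence "u \<in> order_ge 2" using order_ge_diff_trunc[of "br y z" 1] by (simp add: u_def numeral_2_eq_2)
    hence "br x u \<in> order_ge (1 + 2 - 1)"
      unfolding br_def using \<pi> order_ge that by (intro pairing_order_ge) simp_all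
    hence "br x u \<in> order_ge 2" by (simp add: numeral_2_eq_2)
    moreover have "br x (homog 1 (br y z)) = br x (br y z) - br x u"
    proof -
      have "br x (homog 1 (br y z) + u) = br x (homog 1 (br y z)) + br x u"
        using P'(5)[of x "homog 1 (br y z) + u"] P'(5)[of x "homog 1 (br y z)"] P'(5)[of x u]
        by (simp add: P'(7))
      thus ?thesis by (simp add: u_def)
    qed
    ultimately have "homog 1 (br x (homog 1 (br y z))) = homog 1 (br x (br y z))"
      using homog_eq_0[of "br x u" 2 1] by (simp add: homog_diff)
    moreover have "b x (b y z) = homog 1 (br x (b y z))" using that by (intro b bmem)
    ultimately show ?thesis unfolding b[OF that(2,3)] by simp
  qed
  have "poly_lie_algebra S b"
  proof
    show "0 \<in> S" using homog_eq_0[of "0 :: 'a mpoly" 2 1] by (simp add: S_def)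
    show "b (x + y) z = b x z + b y z" if "x \<in> S" "y \<in> S" "z \<in> S" for x y z
      using that by (simp add: b add P'(7) homog_add)
    show "b (Const c * x) y = Const c * b x y" if "x \<in> S" "y \<in> S" for c x y
      using that by (simp add: b scale P'(6) homog_Const_mult)
    show "b x y = - b y x" if "x \<in> S" "y \<in> S" for x y
      using that P'(5)[of x y] by (simp add: b homog_uminus[symmetric])
    show "b x (b y z) + b y (b z x) + b z (b x y) = 0" if "x \<in> S" "y \<in> S" "z \<in> S" for x y z
      using that P'(8)[of x y z] homog_eq_0[of "0 :: 'a mpoly" 2 1] by (simp add: bb homog_add[symmetric])
  qed (use bmem add scale in auto)
  thus ?thesis by (simp add: S_def b_def)
qed

section \<open>Pulling back along a Poisson embedding\<close>

lemma poisson_hom_zero: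
  assumes "poisson_hom A brA B brB \<phi>"
  shows "\<phi> 0 = 0"
  using poisson_homD(1)[OF assms, of 0] by simp

text \<open>A polynomial without constant term is a combination of coordinates, and these are mapped to polynomials vanishing at
  the origin; constants are preserved.\<close>

lemma const_coeff_poisson_hom:
  fixes \<phi> :: "('n::finite) mpoly \<Rightarrow> ('v::finite) mpoly"
  assumes H: "poisson_hom UNIV brA B brB \<phi>" and coord: "\<And>i. \<phi> (coord i) \<in> order_ge 1"
  shows "Poly_Mapping.lookup (\<phi> f) 0 = Poly_Mapping.lookup f 0"
proof -
  note h = poisson_homD[OF H, simplified]
  define c where "c = Poly_Mapping.lookup f 0"
  have "\<phi> r \<in> order_ge 1" if "r \<in> order_ge (Suc 0)" for r
    using that
  proof (induction rule: order_ge_Suc_induct)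
    case (coord_mult i g)
    show ?case using order_ge_mult[OF coord[of i] order_ge_0, of "\<phi> g"] by (simp add: h)
  qed (simp_all add: h poisson_hom_zero[OF H] order_ge_add)
  moreover have "f - Const c \<in> order_ge 1"
    by (simp only: order_ge_1_iff) (simp add: lookup_minus lookup_Const c_def)
  ultimately have "Poly_Mapping.lookup (\<phi> (f - Const c)) 0 = 0"
    by (simp add: order_ge_1_iff[symmetric])
  moreover have "\<phi> (Const c + (f - Const c)) = Const c + \<phi> (f - Const c)"
    by (simp only: h)
  ultimately show ?thesis by (simp add: lookup_add lookup_Const c_def)
qed

text \<open>The projection sends a linear form \<open>x\<close> to the class of \<open>\<phi> x\<close>. Every \<open>f\<close> in \<open>\<mm>\<close> is \<open>\<phi> u\<close> with \<open>u\<close> in \<open>\<nn>\<close>, and \<open>u\<close> differs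
  from its linear part by an element of \<open>\<nn>\<^sup>2\<close>, which \<open>\<phi>\<close> sends to \<open>\<mm>\<^sup>2\<close>; this gives surjectivity, and
  applied to \<open>u = {x,y}\<close> it gives compatibility with the brackets.\<close>

lemma lie_extension_linearised_embedding:
  fixes \<pi> :: "('n::finite) bivector" and \<phi> :: "'n mpoly \<Rightarrow> ('v::finite) mpoly"
  assumes P: "poisson_algebra UNIV (pairing \<pi>)" and \<pi>: "\<And>i j. \<pi> i j \<in> order_ge 1"
    and H: "poisson_hom UNIV (pairing \<pi>) A B \<phi>" and onto: "\<phi> ` UNIV = A"
    and coord: "\<And>i. \<phi> (coord i) \<in> order_ge 1"
    and van: "\<And>f g. f \<in> A \<Longrightarrow> g \<in> A \<Longrightarrow> B f g \<in> order_ge 1"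
  shows "lie_extension (linear_lie_algebra (homog_bivector 1 \<pi>))
    (lie_quotient (poly_lie (A \<inter> order_ge 1) B)
       (ideal_prod (poly_ring\<lparr>carrier := A\<rparr>) (A \<inter> order_ge 1) (A \<inter> order_ge 1)))"
proof -
  define m where "m = A \<inter> order_ge 1"
  define J where "J = ideal_prod (poly_ring\<lparr>carrier := A\<rparr>) m m"
  define S :: "'n mpoly set" where "S = {f. homog 1 f = f}"
  define b where "b = pairing (homog_bivector 1 \<pi>)"
  note h = poisson_homD[OF H, simplified]
  interpret g: poly_lie_algebra S b
    unfolding S_def b_def using P \<pi> by (rule poly_lie_algebra_linear_forms)
  interpret q: poly_lie_ideal m B J
    unfolding m_def J_def
    using poisson_algebra_image[OF P H onto] van by (rule poisson_maximal_ideal_lie_ideal)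
  have phi_A: "\<phi> f \<in> A" for f using onto by blast
  have phi_order_ge: "\<phi> f \<in> order_ge 1 \<longleftrightarrow> f \<in> order_ge 1" for f
    by (simp only: order_ge_1_iff const_coeff_poisson_hom[OF H coord])
  have phi_m: "\<phi> f \<in> m" if "f \<in> order_ge 1" for f
    using that phi_A phi_order_ge by (simp add: m_def)
  have S_order_ge: "f \<in> order_ge 1" if "f \<in> S" for f using that linear_form_order_ge by (simp add: S_def)
  have square: "\<phi> r \<in> J" if "r \<in> order_ge 2" for r
    using that[unfolded numeral_2_eq_2]
  proof (induction rule: order_ge_Suc_induct)
    case (coord_mult i u)
    hence "\<phi> (coord i) \<in> m" "\<phi> u \<in> m" using coord phi_A phi_m by (simp_all add: m_def)
    from ideal_prod.prod[OF this, of "poly_ring\<lparr>carrier := A\<rparr>"]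
    show ?case by (simp add: h J_def ring_of_type_algebra_def)
  qed (simp_all add: h poisson_hom_zero[OF H] q.ideal_zero q.ideal_add)
  have lin: "\<phi> f - \<phi> (homog 1 f) \<in> J" if "f \<in> order_ge 1" for f
  proof -
    have "f - homog 1 f \<in> order_ge 2" using order_ge_diff_trunc[OF that, of 1] by (simp add: numeral_2_eq_2)
    moreover have "\<phi> f = \<phi> (homog 1 f) + \<phi> (f - homog 1 f)" by (simp only: h(2)[symmetric]) simp
    ultimately show ?thesis using square by simp
  qed
  have bracket: "B (\<phi> x) (\<phi> y) - \<phi> (b x y) \<in> J" if "x \<in> S" "y \<in> S" for x y
  proof -
    have "pairing \<pi> x y \<in> order_ge 1" using pairing_order_ge[OF \<pi> S_order_ge S_order_ge, of x y] that by simp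
    moreover have "b x y = homog 1 (pairing \<pi> x y)"
      using that pairing_homog_linear_forms unfolding b_def S_def by blast
    ultimately show ?thesis using lin[of "pairing \<pi> x y"] by (simp add: h)
  qed
  (* The kernel N is realised inside the linear forms, with the identity as inclusion. *)
  define p where "p x = q.cls (\<phi> x)" for x
  define N where "N = {x \<in> S. \<phi> x \<in> J}"
  have sc: "\<phi> (Const c * x) = Const c * \<phi> x" for c x by (simp add: h)
  have N: "poly_lie_algebra N b"
  proof (rule g.subalgebra)
    show "N \<subseteq> S" by (auto simp: N_def)
    show "0 \<in> N" by (simp add: N_def poisson_hom_zero[OF H] q.ideal_zero g.zero_mem)
    show "x + y \<in> N" if "x \<in> N" "y \<in> N" for x y
      using that by (simp add: N_def h q.ideal_add g.add_mem)
    show "Const c * x \<in> N" if "x \<in> N" for c x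
      using that by (simp add: N_def sc q.ideal_scale g.scale_mem)
    show "b x y \<in> N" if "x \<in> N" "y \<in> N" for x y
    proof -
      have "B (\<phi> x) (\<phi> y) \<in> J"
        using that q.ideal_br[of "\<phi> x" "\<phi> y"] q.ideal_mem by (simp add: N_def)
      hence "\<phi> (b x y) \<in> J"
        using q.ideal_diff[OF _ bracket[of x y], of "B (\<phi> x) (\<phi> y)"] that by (simp add: N_def)
      thus ?thesis using that by (simp add: N_def g.br_mem)
    qed
  qed
  have p_hom: "p \<in> lie_hom (poly_lie S b) (lie_quotient (poly_lie m B) J)"
    unfolding lie_hom_def
    using bracket phi_m S_order_ge
    by (auto simp: p_def q.Q_carrier q.Q_add q.Q_smult q.Q_bracket h sc q.cls_eq_iff
        intro: q.ideal_uminus[of "_ - _", simplified])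
  have p_onto: "p ` S = q.cls ` m"
  proof safe
    fix f assume f: "f \<in> m"
    then obtain u where u: "f = \<phi> u" using onto by (auto simp: m_def)
    hence "u \<in> order_ge 1" using f phi_order_ge by (simp add: m_def)
    hence "q.cls f = p (homog 1 u)"
      unfolding p_def q.cls_eq_iff u by (rule lin)
    moreover have "homog 1 u \<in> S" by (simp add: S_def homog_idem)
    ultimately show "q.cls f \<in> p ` S" by (rule image_eqI)
  qed (use phi_m S_order_ge in \<open>auto simp: p_def\<close>)
  have "lie_short_exact (poly_lie N b) id (poly_lie S b) p (lie_quotient (poly_lie m B) J)"
    unfolding lie_short_exact_def
    using poly_lie_algebra.real_lie_algebra_poly_lie[OF N] g.real_lie_algebra_poly_lie
      q.real_lie_algebra_quotient p_hom p_onto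
    by (auto simp: lie_hom_def N_def p_def q.Q_carrier q.Q_zero q.cls_eq_iff)
  thus ?thesis
    unfolding lie_extension_def linear_lie_algebra_eq S_def b_def m_def J_def by blast
qed


section \<open>Invariants of a symplectic group with isolated fixed point\<close>

lemma peval_0: "peval f 0 = Poly_Mapping.lookup f 0"
proof -
  have "(\<Prod>i\<in>UNIV. (0 :: real) ^ Poly_Mapping.lookup e i) = (if e = 0 then 1 else 0)" for e :: "'a \<Rightarrow>\<^sub>0 nat"
    by (auto simp: power_0_left prod_zero_iff poly_mapping_eq_iff fun_eq_iff)
  hence "peval f 0 = (\<Sum>e\<in>Poly_Mapping.keys f. if e = 0 then Poly_Mapping.lookup f e else 0)"
    unfolding peval_def by (intro sum.cong) auto
  thus ?thesis by (simp add: not_in_keys_iff_lookup_eq_zero)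
qed

definition linear_part :: "('i::finite) mpoly \<Rightarrow> real ^ 'i \<Rightarrow> real" where
  "linear_part f v = (\<Sum>i\<in>UNIV. Poly_Mapping.lookup f (Poly_Mapping.single i 1) * v $ i)"

text \<open>Along a ray a monomial of degree \<open>d\<close> is a constant times \<open>t ^ d\<close>, so only degree \<open>1\<close> survives. This ties the
  coefficients of the linear part to the polynomial function, in terms of which invariance is stated.\<close>

lemma peval_directional_derivative_at_0:
  "((\<lambda>t. peval f (t *\<^sub>R v)) has_real_derivative linear_part f v) (at 0)"
proof -
  define m where "m e = (\<Prod>i\<in>UNIV. v $ i ^ Poly_Mapping.lookup e i)" for e
  have eq: "(\<lambda>t. peval f (t *\<^sub>R v)) =
      (\<lambda>t. \<Sum>e\<in>Poly_Mapping.keys f. Poly_Mapping.lookup f e * m e * t ^ mon_degree e)"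
    by (simp add: peval_def m_def power_mult_distrib prod.distrib power_sum mon_degree_def mult_ac)
  have "((\<lambda>t. \<Sum>e\<in>Poly_Mapping.keys f. Poly_Mapping.lookup f e * m e * t ^ mon_degree e)
      has_real_derivative (\<Sum>e\<in>Poly_Mapping.keys f. Poly_Mapping.lookup f e * m e * (if mon_degree e = 1 then 1 else 0))) (at 0)"
    by (intro DERIV_sum DERIV_cmult) (auto intro!: derivative_eq_intros simp: power_0_left)
  also have "(\<Sum>e\<in>Poly_Mapping.keys f. Poly_Mapping.lookup f e * m e * (if mon_degree e = 1 then 1 else 0))
      = (\<Sum>e\<in>range (\<lambda>i. Poly_Mapping.single i 1). Poly_Mapping.lookup f e * m e)"
  proof (rule sum.mono_neutral_cong)
    fix e assume "e \<in> Poly_Mapping.keys f - range (\<lambda>i. Poly_Mapping.single i 1)"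
    hence "mon_degree e \<noteq> 1"
      using mon_degree_Suc_split[of e 0] by (metis DiffD2 One_nat_def add.right_neutral mon_degree_eq_0_iff rangeI)
    thus "Poly_Mapping.lookup f e * m e * (if mon_degree e = 1 then 1 else 0) = 0" by simp
  qed (auto simp: not_in_keys_iff_lookup_eq_zero)
  also have "\<dots> = (\<Sum>i\<in>UNIV. Poly_Mapping.lookup f (Poly_Mapping.single i 1) * m (Poly_Mapping.single i 1))"
  proof -
    have "inj (\<lambda>i :: 'a. Poly_Mapping.single i (1 :: nat))"
      by (rule injI) (metis lookup_single_eq lookup_single_not_eq zero_neq_one)
    thus ?thesis by (simp add: sum.reindex)
  qed
  also have "\<dots> = linear_part f v"
  proof -
    have "m (Poly_Mapping.single i 1) = v $ i" for i
    proof -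
      have "m (Poly_Mapping.single i 1) = (\<Prod>j\<in>UNIV. if j = i then v $ j else 1)"
        unfolding m_def by (intro prod.cong) (auto simp: lookup_single when_def)
      thus ?thesis by simp
    qed
    thus ?thesis by (simp add: linear_part_def)
  qed
  finally show ?thesis unfolding eq .
qed

lemma linear_part_invariant:
  assumes "f \<in> invariant_polys G" "A \<in> G"
  shows "linear_part f (A *v v) = linear_part f v"
proof -
  have "peval f (t *\<^sub>R (A *v v)) = peval f (t *\<^sub>R v)" for t
    using assms by (simp add: invariant_polys_def matrix_vector_mult_scaleR[symmetric])
  hence "((\<lambda>t. peval f (t *\<^sub>R v)) has_real_derivative linear_part f (A *v v)) (at 0)"
    using peval_directional_derivative_at_0[of f "A *v v"] by simp
  thus ?thesis using peval_directional_derivative_at_0 DERIV_unique by blast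
qed

lemma sum_UNIV_Plus:
  "(\<Sum>i\<in>(UNIV :: ('a::finite + 'b::finite) set). f i) = (\<Sum>i\<in>UNIV. f (Inl i)) + (\<Sum>i\<in>UNIV. f (Inr i))"
  by (subst UNIV_Plus_UNIV[symmetric], subst sum.Plus) auto

text \<open>Pairing with a position basis vector reads off a momentum coordinate, and conversely.\<close>

lemma omega_nondegenerate:
  assumes "\<And>v. omega u v = 0"
  shows "u = 0"
proof -
  have "omega u (axis j 1) = (case j of Inl i \<Rightarrow> - u $ Inr i | Inr i \<Rightarrow> u $ Inl i)" for j
    by (cases j) (simp_all add: omega_def axis_def sum_subtractf sum_negf mult_delta_right)
  hence "u $ i = 0" for i
    using assms by (cases i) (metis sum.case neg_equal_0_iff_equal)+
  thus ?thesis by (simp add: vec_eq_iff)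
qed

lemma omega_diff_left: "omega (u - u') v = omega u v - omega u' v"
  by (simp add: omega_def algebra_simps sum_subtractf sum.distrib)

text \<open>Let \<open>w\<close> represent the linear part through the symplectic form. Invariance gives
  \<open>\<omega>(A w - w, A v) = \<omega>(w,v) - \<omega>(w, A v) = 0\<close> for all \<open>v\<close>; as \<open>A\<close> is surjective, \<open>w\<close> is fixed by \<open>G\<close>. Then the
  line through \<open>w\<close> is fixed, and it meets every neighbourhood of the origin outside \<open>0\<close> unless \<open>w = 0\<close>.\<close>

lemma linear_part_invariant_imp_zero:
  fixes G :: "(real ^ ('m::finite + 'm) ^ ('m + 'm)) set"
  assumes "G \<subseteq> Sp" "0 isolated_in fixed_points G" "f \<in> invariant_polys G"
  shows "Poly_Mapping.lookup f (Poly_Mapping.single i 1) = 0"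
proof -
  define c where "c i = Poly_Mapping.lookup f (Poly_Mapping.single i 1)" for i
  define w :: "real ^ ('m + 'm)"
    where "w = (\<chi> i. case i of Inl a \<Rightarrow> c (Inr a) | Inr a \<Rightarrow> - c (Inl a))"
  have w: "omega w v = linear_part f v" for v
    by (simp add: omega_def w_def linear_part_def c_def sum_UNIV_Plus sum.distrib)
  have "A *v w = w" if A: "A \<in> G" for A
  proof -
    have Sp: "omega (A *v u) (A *v v) = omega u v" for u v
      using A assms(1) by (auto simp: Sp_def)
    have "A *v u \<noteq> 0" if "u \<noteq> 0" for u
      using omega_nondegenerate[of u] Sp[of u] that by (auto simp: omega_def)
    hence "inj ((*v) A)"
      by (subst linear_injective_0) auto
    hence surj: "surj ((*v) A)"
      by (intro linear_injective_imp_surjective) auto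
    have "omega (A *v w - w) (A *v v) = 0" for v
      using linear_part_invariant[OF assms(3) A] by (simp add: omega_diff_left Sp w)
    hence "omega (A *v w - w) v = 0" for v
      using surj by (metis surj_f_inv_f)
    thus ?thesis using omega_nondegenerate by fastforce
  qed
  hence fixed: "t *\<^sub>R w \<in> fixed_points G" for t
    by (simp add: fixed_points_def matrix_vector_mult_scaleR)
  have "w = 0"
  proof (rule ccontr)
    assume "w \<noteq> 0"
    obtain e where e: "e > 0" "\<And>y. y \<in> fixed_points G \<Longrightarrow> dist 0 y < e \<Longrightarrow> y = 0"
      using assms(2) unfolding isolated_in_dist_Ex_iff by blast
    (* The multiple of w of length e/2 is a fixed point inside the isolating ball. *)
    have "dist 0 ((e / (2 * norm w)) *\<^sub>R w) < e"
      using e \<open>w \<noteq> 0\<close> by simp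
    hence "(e / (2 * norm w)) *\<^sub>R w = 0" using e(2) fixed by blast
    thus False using e \<open>w \<noteq> 0\<close> by simp
  qed
  hence "c i = 0"
    unfolding w_def vec_eq_iff by (cases i) (auto split: sum.splits dest: spec[of _ "Inr _"] spec[of _ "Inl _"])
  thus ?thesis by (simp add: c_def)
qed

lemma canonical_bracket_vanishes_at_0:
  assumes "\<And>i. Poly_Mapping.lookup f (Poly_Mapping.single i 1) = 0"
    and "\<And>i. Poly_Mapping.lookup g (Poly_Mapping.single i 1) = 0"
  shows "canonical_bracket f g \<in> order_ge 1"
proof -
  have "pdiff i f \<in> order_ge 1" "pdiff i g \<in> order_ge 1" for i
    using assms by (simp_all only: order_ge_1_iff lookup_pdiff) simp_all
  hence "pdiff i f * pdiff j g \<in> order_ge 1" for i j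
    using order_ge_mult[OF _ order_ge_0, of "pdiff i f" 1 "pdiff j g"] by simp
  thus ?thesis unfolding canonical_bracket_def by (intro order_ge_sum order_ge_diff)
qed

lemma max_ideal_0_eq: "max_ideal_0 G = invariant_polys G \<inter> order_ge 1"
  by (auto simp only: max_ideal_0_def peval_0 order_ge_1_iff)

section \<open>The linearisation and its obstruction equations\<close>

theorem theorem4p4p1:
  fixes G :: "(real ^ ('m::finite + 'm) ^ ('m + 'm)) set"
    and br :: "('n::finite) mpoly \<Rightarrow> 'n mpoly \<Rightarrow> 'n mpoly"
    and \<pi> :: "'n bivector"
    and F_star :: "'n mpoly \<Rightarrow> ('m + 'm) mpoly"
  assumes "compact_symplectic_group G"
    and "0 isolated_in fixed_points G"
    and "poisson_algebra UNIV br"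
    and "is_bivector_of \<pi> br"
    and "poisson_hom UNIV br (invariant_polys G) canonical_bracket F_star"
    and "F_star ` UNIV = invariant_polys G"
    and "dual_map F_star 0 = 0"
  shows "(\<exists>N. \<pi> = trunc_bivector N \<pi>) \<and>
    (\<forall>k\<ge>1. nbhd_bivector k \<pi> = nbhd_bivector k (trunc_bivector k \<pi>) \<and>
       nbhd_trivector k (schouten (trunc_bivector k \<pi>) (trunc_bivector k \<pi>))
         = nbhd_trivector k (\<lambda>i j l. 0)) \<and>
    lie_extension (linear_lie_algebra (homog_bivector 1 \<pi>)) (cotangent_lie_algebra G) \<and>
    (\<forall>k\<ge>2. nbhd_trivector k (d_lie (homog_bivector 1 \<pi>) (homog_bivector k \<pi>))
       = nbhd_trivector k (\<lambda>i j l. Const (- 1 / 2) *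
           schouten (trunc_bivector (k - 1) \<pi>) (trunc_bivector (k - 1) \<pi>) i j l))"
proof -
  have br: "br = pairing \<pi>"
    using assms(4) by (auto simp: is_bivector_of_def fun_eq_iff)
  note P = assms(3)[unfolded br] and H = assms(5)[unfolded br]
  have van: "canonical_bracket f g \<in> order_ge 1" if "f \<in> invariant_polys G" "g \<in> invariant_polys G" for f g
    using that assms(1) linear_part_invariant_imp_zero[OF _ assms(2)]
    by (intro canonical_bracket_vanishes_at_0) (auto simp: compact_symplectic_group_def)
  have coord: "F_star (coord i) \<in> order_ge 1" for i
    using assms(7) by (simp only: order_ge_1_iff) (simp add: dual_map_def vec_eq_iff peval_0)
  have \<pi>: "\<pi> i j \<in> order_ge 1" for i j
  proof -
    have "F_star (\<pi> i j) = canonical_bracket (F_star (coord i)) (F_star (coord j))"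
      using poisson_homD(4)[OF H, of "coord i" "coord j"] by (simp add: pairing_coord)
    hence "F_star (\<pi> i j) \<in> order_ge 1" using van assms(6) by (metis rangeI)
    thus ?thesis by (simp only: order_ge_1_iff const_coeff_poisson_hom[OF H coord])
  qed
  have jacobi: "schouten \<pi> \<pi> i j l = 0" for i j l
    unfolding schouten_self_jacobiator using poisson_algebraD(8)[OF P] by simp
  have "\<exists>N. \<pi> = trunc_bivector N \<pi>"
  proof -
    (* If the bivector is zero then N is the maximum of the empty set; no monomial has to be bounded then. *)
    define N where "N = Max (mon_degree ` (\<Union>i j. Poly_Mapping.keys (\<pi> i j)))"
    have "mon_degree e \<le> N" if "Poly_Mapping.lookup (\<pi> i j) e \<noteq> 0" for i j e
      unfolding N_def using that by (intro Max_ge imageI UN_I[of i] UN_I[of j]) (auto simp: in_keys_iff)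
    hence "\<pi> i j = trunc_bivector N \<pi> i j" for i j
      unfolding trunc_bivector_def homog_bivector_def using \<pi> by (intro trunc_eventually_exact)
    thus ?thesis by (intro exI[of _ N] ext)
  qed
  moreover have "nbhd_bivector k \<pi> = nbhd_bivector k (trunc_bivector k \<pi>)" for k
    unfolding nbhd_bivector_def trunc_bivector_def homog_bivector_def
    by (intro ext nbhd_class_eqI order_ge_diff_trunc \<pi>)
  moreover have "nbhd_trivector k (schouten (trunc_bivector k \<pi>) (trunc_bivector k \<pi>))
      = nbhd_trivector k (\<lambda>i j l. 0)" if "1 \<le> k" for k
    unfolding nbhd_trivector_def using schouten_trunc_self[OF \<pi> jacobi that]
    by (intro ext nbhd_class_eqI) simp
  moreover have "lie_extension (linear_lie_algebra (homog_bivector 1 \<pi>)) (cotangent_lie_algebra G)"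
    unfolding cotangent_lie_algebra_def max_ideal_0_eq invariant_ring_def
    using P \<pi> H assms(6) coord van by (rule lie_extension_linearised_embedding)
  moreover have "nbhd_trivector k (d_lie (homog_bivector 1 \<pi>) (homog_bivector k \<pi>))
      = nbhd_trivector k (\<lambda>i j l. Const (- 1 / 2) *
          schouten (trunc_bivector (k - 1) \<pi>) (trunc_bivector (k - 1) \<pi>) i j l)" if "2 \<le> k" for k
    unfolding nbhd_trivector_def d_lie_def
    by (intro ext nbhd_class_eqI maurer_cartan_defect \<pi> jacobi that)
  ultimately show ?thesis by blast
qed

end
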